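(* Let $\hat G=(I,P;E)$ be a pinned $\mathcal S$-isostatic graph in dimension $d$, where the action $\theta$ of the finite group $\mathcal S$ is free on the vertices, and let $(\hat H,\psi)$ be its quotient $\mathcal S$-gain graph. Then for any $\mathcal S$-directed orientation of $\hat H$ the following three decompositions coincide, i.e. they give the same partition of the inner vertex orbits $\hat I$ into components and the same partial order on these components (with the ground at the bottom): (1) the $\mathcal S$-Assur decomposition of $\hat G$; (2) the decomposition of the $\mathcal S$-directed orientation of $\hat H$ into strongly connected components; (3) the induced block graph of a maximal lower block-triangular decomposition of the pinned orbit matrix $\mathcal O_{pin}(\hat H,\psi,\tilde{\mathbf p})$ (at a pinned $\mathcal S$-regular realisation).
   Context: A pinned graph $\hat G=(I,P;E)$ is a finite simple graph on the disjoint vertex set $I\cup P$ ($I$ = inner vertices, $P$ = pinned vertices); no edge joins two pinned vertices. $\mathcal S$ is a finite group acting on $\hat G$ by $\theta:\mathcal S\to\mathrm{Aut}(\hat G)$ mapping $I$ to $I$ and $P$ to $P$ (write $xv=\theta(x)(v)$), and $\tau:\mathcal S\to O(\mathbb R^d)$ is a homomorphism. A pinned framework $(\hat G,\mathbf p)$, $\mathbf p:I\cup P\to\mathbb R^d$, is $\mathcal S$-symmetric if $\tau(x)\mathbf p(v)=\mathbf p(xv)$ for all $x\in\mathcal S$, $v\in I\cup P$. Quotient $\mathcal S$-gain graph (free action on vertices): its vertices are the vertex orbits, split into inner orbits $\hat I$ and pinned orbits $\hat P$; fix a representative $v$ of each orbit. Each edge orbit joining orbits $\mathcal S u,\mathcal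 S v$ has the form $\{\{xu,xyv\}:x\in\mathcal S\}$ for a unique $y\in\mathcal S$; it gives an edge $\tilde e$ of $\hat H=(\hat I,\hat P;\hat E)$ directed from $\tilde u$ to $\tilde v$ with gain $\psi(\tilde e)=y$ (a loop if $\tilde u=\tilde v$); reversing the reference direction replaces the gain by its inverse. Put $\tilde{\mathbf p}(\tilde v)=\mathbf p(v)$ for the representative $v$. Pinned orbit matrix $\mathcal O_{pin}(\hat H,\psi,\tilde{\mathbf p})$: one row per $\tilde e\in\hat E$, $d$ columns per $\tilde v\in\hat I$, no columns for pinned vertices. For $\tilde e=(\tilde u,\tilde v)$ with $\tilde u\neq\tilde v$ both inner, the row has $\tilde{\mathbf p}(\tilde u)-\tau(\psi(\tilde e))\tilde{\mathbf p}(\tilde v)$ in the columns of $\tilde u$, $\tilde{\mathbf p}(\tilde v)-\tau(\psi(\tilde e))^{-1}\tilde{\mathbf p}(\tilde u)$ in the columns of $\tilde v$, zeros elsewhere; for a loop $\tilde e$ at $\tilde u$ the row has $2\tilde{\mathbf p}(\tilde u)-\tau(\psi(\tilde e))\tilde{\mathbf p}(\tilde u)-\tau(\psi(\tilde e))^{-1}\tilde{\mathbf p}(\tilde u)$ in the columns of $\tilde u$; for $\tilde u$ inner and $\tilde v$ pinned it has $\tilde{\mathbf p}(\tilde u)-\tau(\psi(\tilde e))\tilde{\mathbf p}(\tilde v)$ in the columns of $\tilde u$ and zeros elsewhere. A realisation is pinned $\mathcal S$-regular if this matrix has maximal rank among all $\mathcal S$-symmetric pinned realisations of $\hat G$. $\hat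 G$ is pinned $\mathcal S$-isostatic if at pinned $\mathcal S$-regular realisations $\mathcal O_{pin}$ is square and invertible (equivalently $|\hat E|=d|\hat I|$ and rank $d|\hat I|$). A sub-pinned graph is an $\mathcal S$-invariant subgraph with at least one inner vertex, with the inherited inner/pinned labelling; $\hat G$ is $\mathcal S$-Assur if it is pinned $\mathcal S$-isostatic and has no proper pinned $\mathcal S$-isostatic sub-pinned graph. $\mathcal S$-directed orientation of $\hat H$: an orientation of its edges in which every inner vertex has out-degree exactly $d$ (a loop contributing $1$) and every pinned vertex has out-degree $0$. $\mathcal S$-Assur decomposition: starting with the ground (the pinned vertices), repeatedly choose a minimal nonempty set $C$ of not yet grounded inner vertex orbits such that $C$ together with all edges from $C$ to $C$ or to already grounded vertices (the latter now regarded as pins) forms a pinned $\mathcal S$-isostatic graph, and then add $C$ to the ground; the components are the chosen sets $C$, each together with its outgoing edges (extended component) being $\mathcal S$-Assur; a component $A$ lies directly above a component $B$ (or the ground) if some edge of $\hat H$ joins a vertex of $A$ to a vertex of $B$ (resp. a pinned vertex) and $B$ was grounded before $A$; the partial order is the transitive closure. Strongly connected component decomposition: identify all pinned vertices to a single sink $Z$ (the ground); the strongly connected components of the inner vertices, with the acyclic condensation (component $A$ above $B$ if there is a directed path from $A$ to $B$), give the partial order. Maximal lower block-triangular decomposition: permute the rows and the inner vertex orbits (keeping each vertex's columns together) so that the matrix is block lower-triangular with square diagonal blocks that admit no further such decomposition. Induced block graph: one vertex per block plus a ground vertex $Z$; an arc $(A,B)$ if some edge whose row lies in block $A$ has an endpoint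 among the inner vertices of block $B\neq A$, and an arc $(A,Z)$ if some edge in block $A$ goes to a pinned vertex. *)

theory Defs
  imports
    "HOL-Analysis.Analysis"
    "HOL-Algebra.Group_Action"
    "Graph_Theory.Digraph_Component"
begin

section \<open>Symmetric pinned graphs\<close>

record 'v pinned_graph =
  inner :: "'v set"
  pinned :: "'v set"
  edges :: "'v set set"

definition pinned_graph :: "'v pinned_graph \<Rightarrow> bool" where
  "pinned_graph G \<longleftrightarrow>
     finite (inner G) \<and> finite (pinned G) \<and> inner G \<inter> pinned G = {} \<and>
     (\<forall>e\<in>edges G. e \<subseteq> inner G \<union> pinned G \<and> card e = 2 \<and> \<not> e \<subseteq> pinned G)"

definition acts_on_pinned_graph ::
  "('g, 'b) monoid_scheme \<Rightarrow> ('g \<Rightarrow> 'v \<Rightarrow> 'v) \<Rightarrow> 'v pinned_graph \<Rightarrow> bool" where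
  "acts_on_pinned_graph S \<theta> G \<longleftrightarrow>
     group_action S (inner G \<union> pinned G) \<theta> \<and>
     (\<forall>x\<in>carrier S. \<theta> x ` inner G = inner G \<and> \<theta> x ` pinned G = pinned G \<and>
        (\<lambda>e. \<theta> x ` e) ` edges G = edges G)"

definition free_on_vertices ::
  "('g, 'b) monoid_scheme \<Rightarrow> ('g \<Rightarrow> 'v \<Rightarrow> 'v) \<Rightarrow> 'v pinned_graph \<Rightarrow> bool" where
  "free_on_vertices S \<theta> G \<longleftrightarrow>
     (\<forall>v\<in>inner G \<union> pinned G. stabilizer S \<theta> v = {\<one>\<^bsub>S\<^esub>})"

definition orthogonal_group :: "(real^'d^'d) monoid" where
  "orthogonal_group =
     \<lparr>carrier = {A. orthogonal_matrix A}, monoid.mult = (**), one = mat 1\<rparr>"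

abbreviation inner_orbits ::
  "('g, 'b) monoid_scheme \<Rightarrow> ('g \<Rightarrow> 'v \<Rightarrow> 'v) \<Rightarrow> 'v pinned_graph \<Rightarrow> 'v set set" where
  "inner_orbits S \<theta> G \<equiv> orbits S (inner G) \<theta>"

abbreviation pinned_orbits ::
  "('g, 'b) monoid_scheme \<Rightarrow> ('g \<Rightarrow> 'v \<Rightarrow> 'v) \<Rightarrow> 'v pinned_graph \<Rightarrow> 'v set set" where
  "pinned_orbits S \<theta> G \<equiv> orbits S (pinned G) \<theta>"

abbreviation edge_orbits ::
  "('g, 'b) monoid_scheme \<Rightarrow> ('g \<Rightarrow> 'v \<Rightarrow> 'v) \<Rightarrow> 'v pinned_graph \<Rightarrow> 'v set set set" where
  "edge_orbits S \<theta> G \<equiv> orbits S (edges G) (\<lambda>x e. \<theta> x ` e)"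

section \<open>Quotient gain graphs and the pinned orbit matrix\<close>

text \<open>
  The quotient is a multidigraph whose vertices are vertex orbits and whose arcs are edge orbits;
  \<open>tail\<close> and \<open>head\<close> give the reference direction.
\<close>

record ('v, 'g) gain_graph = "('v set, 'v set set) pre_digraph" +
  rep :: "'v set \<Rightarrow> 'v"
  gain :: "'v set set \<Rightarrow> 'g"

definition quotient_gain_graph ::
  "('g, 'b) monoid_scheme \<Rightarrow> ('g \<Rightarrow> 'v \<Rightarrow> 'v) \<Rightarrow> 'v pinned_graph \<Rightarrow> ('v, 'g) gain_graph \<Rightarrow> bool"
where
  "quotient_gain_graph S \<theta> G H \<longleftrightarrow>
     verts H = inner_orbits S \<theta> G \<union> pinned_orbits S \<theta> G \<and>
     arcs H = edge_orbits S \<theta> G \<and>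
     (\<forall>w\<in>verts H. rep H w \<in> w) \<and>
     (\<forall>e\<in>arcs H. tail H e \<in> verts H \<and> head H e \<in> verts H \<and> gain H e \<in> carrier S \<and>
        e = {{\<theta> x (rep H (tail H e)), \<theta> (x \<otimes>\<^bsub>S\<^esub> gain H e) (rep H (head H e))} |x. x \<in> carrier S})"

definition orbit_entry ::
  "('g \<Rightarrow> real^'d^'d) \<Rightarrow> ('v, 'g) gain_graph \<Rightarrow> ('v set \<Rightarrow> real^'d) \<Rightarrow> 'v set set \<Rightarrow> 'v set \<Rightarrow> real^'d"
where
  "orbit_entry \<tau> H q e w =
     (let u = tail H e; v = head H e; A = \<tau> (gain H e) in
      if u = v \<and> w = u then 2 *\<^sub>R q u - A *v q u - matrix_inv A *v q u
      else if w = u then q u - A *v q v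
      else if w = v then q v - matrix_inv A *v q u
      else 0)"

text \<open>
  Rows are indexed by all elements of type \<open>'v set set\<close>, and columns by all pairs of a set of
  vertices and a coordinate. Rows that are not edge orbits and columns that do not belong to an
  inner orbit are zero; they do not affect the rank.
\<close>

definition pinned_orbit_matrix ::
  "('g, 'b) monoid_scheme \<Rightarrow> ('g \<Rightarrow> 'v \<Rightarrow> 'v) \<Rightarrow> ('g \<Rightarrow> real^'d^'d) \<Rightarrow> 'v::finite pinned_graph \<Rightarrow>
   ('v, 'g) gain_graph \<Rightarrow> ('v set \<Rightarrow> real^'d) \<Rightarrow> real^('v set \<times> 'd)^('v set set)"
where
  "pinned_orbit_matrix S \<theta> \<tau> G H q =
     (\<chi> e c. if e \<in> arcs H \<and> fst c \<in> inner_orbits S \<theta> G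
             then orbit_entry \<tau> H q e (fst c) $ snd c else 0)"

abbreviation pinned_orbit_matrix_at ::
  "('g, 'b) monoid_scheme \<Rightarrow> ('g \<Rightarrow> 'v \<Rightarrow> 'v) \<Rightarrow> ('g \<Rightarrow> real^'d^'d) \<Rightarrow> 'v::finite pinned_graph \<Rightarrow>
   ('v, 'g) gain_graph \<Rightarrow> ('v \<Rightarrow> real^'d) \<Rightarrow> real^('v set \<times> 'd)^('v set set)"
where
  "pinned_orbit_matrix_at S \<theta> \<tau> G H p \<equiv> pinned_orbit_matrix S \<theta> \<tau> G H (\<lambda>w. p (rep H w))"

section \<open>Pinned isostatic and Assur graphs\<close>

definition symmetric_realisation ::
  "('g, 'b) monoid_scheme \<Rightarrow> ('g \<Rightarrow> 'v \<Rightarrow> 'v) \<Rightarrow> ('g \<Rightarrow> real^'d^'d) \<Rightarrow> 'v pinned_graph \<Rightarrow>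
   ('v \<Rightarrow> real^'d) \<Rightarrow> bool"
where
  "symmetric_realisation S \<theta> \<tau> G p \<longleftrightarrow>
     (\<forall>x\<in>carrier S. \<forall>v\<in>inner G \<union> pinned G. \<tau> x *v p v = p (\<theta> x v))"

definition pinned_regular ::
  "('g, 'b) monoid_scheme \<Rightarrow> ('g \<Rightarrow> 'v \<Rightarrow> 'v) \<Rightarrow> ('g \<Rightarrow> real^'d^'d) \<Rightarrow> 'v::finite pinned_graph \<Rightarrow>
   ('v, 'g) gain_graph \<Rightarrow> ('v \<Rightarrow> real^'d) \<Rightarrow> bool"
where
  "pinned_regular S \<theta> \<tau> G H p \<longleftrightarrow>
     symmetric_realisation S \<theta> \<tau> G p \<and>
     (\<forall>q. symmetric_realisation S \<theta> \<tau> G q \<longrightarrow>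
        rank (pinned_orbit_matrix_at S \<theta> \<tau> G H q) \<le> rank (pinned_orbit_matrix_at S \<theta> \<tau> G H p))"

definition pinned_isostatic ::
  "('g, 'b) monoid_scheme \<Rightarrow> ('g \<Rightarrow> 'v \<Rightarrow> 'v) \<Rightarrow> ('g \<Rightarrow> real^'d^'d) \<Rightarrow> 'v::finite pinned_graph \<Rightarrow> bool"
where
  "pinned_isostatic S \<theta> \<tau> G \<longleftrightarrow>
     card (edge_orbits S \<theta> G) = CARD('d) * card (inner_orbits S \<theta> G) \<and>
     (\<forall>H p. quotient_gain_graph S \<theta> G H \<longrightarrow> pinned_regular S \<theta> \<tau> G H p \<longrightarrow>
        rank (pinned_orbit_matrix_at S \<theta> \<tau> G H p) = CARD('d) * card (inner_orbits S \<theta> G))"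

definition sub_pinned_graph ::
  "('g, 'b) monoid_scheme \<Rightarrow> ('g \<Rightarrow> 'v \<Rightarrow> 'v) \<Rightarrow> 'v pinned_graph \<Rightarrow> 'v pinned_graph \<Rightarrow> bool" where
  "sub_pinned_graph S \<theta> K G \<longleftrightarrow>
     inner K \<noteq> {} \<and> inner K \<subseteq> inner G \<and> pinned K \<subseteq> pinned G \<and> edges K \<subseteq> edges G \<and>
     (\<forall>e\<in>edges K. e \<subseteq> inner K \<union> pinned K) \<and>
     (\<forall>x\<in>carrier S. \<theta> x ` inner K \<subseteq> inner K \<and> \<theta> x ` pinned K \<subseteq> pinned K \<and>
        (\<forall>e\<in>edges K. \<theta> x ` e \<in> edges K))"

definition Assur ::
  "('g, 'b) monoid_scheme \<Rightarrow> ('g \<Rightarrow> 'v \<Rightarrow> 'v) \<Rightarrow> ('g \<Rightarrow> real^'d^'d) \<Rightarrow> 'v::finite pinned_graph \<Rightarrow> bool"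
where
  "Assur S \<theta> \<tau> G \<longleftrightarrow>
     pinned_isostatic S \<theta> \<tau> G \<and>
     \<not> (\<exists>K. sub_pinned_graph S \<theta> K G \<and> K \<noteq> G \<and> pinned_isostatic S \<theta> \<tau> K)"

section \<open>The three decompositions\<close>

text \<open>
  A decomposition is the set of its components together with a strict order ``is above''.
  A component is a set of inner vertex orbits; in the order, \<open>Some A\<close> is the component \<open>A\<close> and
  \<open>None\<close> is the ground.
\<close>

type_synonym 'v decomposition = "'v set set set \<times> ('v set set option) rel"

subsection \<open>Assur decomposition\<close>

text \<open>\<open>D\<close> is the set of inner vertex orbits that are already grounded.\<close>

definition extended_component ::
  "'v pinned_graph \<Rightarrow> 'v set set \<Rightarrow> 'v set set \<Rightarrow> 'v pinned_graph" where
  "extended_component G D C =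
     (let F = {e \<in> edges G. e \<inter> \<Union>C \<noteq> {} \<and> e \<subseteq> \<Union>C \<union> \<Union>D \<union> pinned G}
      in \<lparr>inner = \<Union>C, pinned = \<Union>F - \<Union>C, edges = F\<rparr>)"

definition groundable ::
  "('g, 'b) monoid_scheme \<Rightarrow> ('g \<Rightarrow> 'v \<Rightarrow> 'v) \<Rightarrow> ('g \<Rightarrow> real^'d^'d) \<Rightarrow> 'v::finite pinned_graph \<Rightarrow>
   'v set set \<Rightarrow> 'v set set \<Rightarrow> bool"
where
  "groundable S \<theta> \<tau> G D C \<longleftrightarrow>
     C \<noteq> {} \<and> C \<subseteq> inner_orbits S \<theta> G - D \<and> pinned_isostatic S \<theta> \<tau> (extended_component G D C)"

text \<open>
  A run of the decomposition procedure: the components in the order in which they are grounded.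
  The run ends only when no further set can be chosen.
\<close>

definition Assur_run ::
  "('g, 'b) monoid_scheme \<Rightarrow> ('g \<Rightarrow> 'v \<Rightarrow> 'v) \<Rightarrow> ('g \<Rightarrow> real^'d^'d) \<Rightarrow> 'v::finite pinned_graph \<Rightarrow>
   'v set set list \<Rightarrow> bool"
where
  "Assur_run S \<theta> \<tau> G Cs \<longleftrightarrow>
     (\<forall>i<length Cs. groundable S \<theta> \<tau> G (\<Union>(set (take i Cs))) (Cs ! i) \<and>
        (\<forall>C. C \<subset> Cs ! i \<longrightarrow> \<not> groundable S \<theta> \<tau> G (\<Union>(set (take i Cs))) C)) \<and>
     \<not> (\<exists>C. groundable S \<theta> \<tau> G (\<Union>(set Cs)) C)"

definition joins :: "('v, 'g) gain_graph \<Rightarrow> 'v set set \<Rightarrow> 'v set set \<Rightarrow> 'v set set \<Rightarrow> bool" where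
  "joins H e A B \<longleftrightarrow>
     tail H e \<in> A \<and> head H e \<in> B \<or> head H e \<in> A \<and> tail H e \<in> B"

definition directly_above ::
  "('g, 'b) monoid_scheme \<Rightarrow> ('g \<Rightarrow> 'v \<Rightarrow> 'v) \<Rightarrow> 'v pinned_graph \<Rightarrow> ('v, 'g) gain_graph \<Rightarrow>
   'v set set list \<Rightarrow> ('v set set option) rel"
where
  "directly_above S \<theta> G H Cs =
     {(Some (Cs ! i), Some (Cs ! j)) |i j.
        j < i \<and> i < length Cs \<and> (\<exists>e\<in>arcs H. joins H e (Cs ! i) (Cs ! j))} \<union>
     {(Some A, None) |A. A \<in> set Cs \<and> (\<exists>e\<in>arcs H. joins H e A (pinned_orbits S \<theta> G))}"

definition Assur_decomposition ::
  "('g, 'b) monoid_scheme \<Rightarrow> ('g \<Rightarrow> 'v \<Rightarrow> 'v) \<Rightarrow> 'v pinned_graph \<Rightarrow> ('v, 'g) gain_graph \<Rightarrow>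
   'v set set list \<Rightarrow> 'v decomposition"
where
  "Assur_decomposition S \<theta> G H Cs = (set Cs, (directly_above S \<theta> G H Cs)\<^sup>+)"

subsection \<open>Strongly connected component decomposition\<close>

definition directed_orientation ::
  "nat \<Rightarrow> ('g, 'b) monoid_scheme \<Rightarrow> ('g \<Rightarrow> 'v \<Rightarrow> 'v) \<Rightarrow> 'v pinned_graph \<Rightarrow> ('v, 'g) gain_graph \<Rightarrow>
   ('v set, 'v set set) pre_digraph \<Rightarrow> bool"
where
  "directed_orientation d S \<theta> G H D \<longleftrightarrow>
     verts D = verts H \<and> arcs D = arcs H \<and>
     (\<forall>e\<in>arcs H. (tail D e, head D e) \<in> {(tail H e, head H e), (head H e, tail H e)}) \<and>
     (\<forall>w\<in>inner_orbits S \<theta> G. out_degree D w = d) \<and>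
     (\<forall>w\<in>pinned_orbits S \<theta> G. out_degree D w = 0)"

text \<open>All pinned vertices are identified to the single vertex \<open>None\<close>.\<close>

definition identify_pins ::
  "'v set set \<Rightarrow> ('v set, 'v set set) pre_digraph \<Rightarrow> ('v set option, 'v set set) pre_digraph" where
  "identify_pins W D =
     (let z = (\<lambda>w. if w \<in> W then Some w else None)
      in \<lparr>verts = insert None (Some ` W), arcs = arcs D, tail = z \<circ> tail D, head = z \<circ> head D\<rparr>)"

definition scc_decomposition ::
  "'v set set \<Rightarrow> ('v set, 'v set set) pre_digraph \<Rightarrow> 'v decomposition" where
  "scc_decomposition W D =
     (let Z = identify_pins W D;
          comps = {C. C \<subseteq> W \<and> Some ` C \<in> pre_digraph.sccs_verts Z}
      in (comps,
          {(Some A, Some B) |A B. A \<in> comps \<and> B \<in> comps \<and> A \<noteq> B \<and>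
             (\<exists>a\<in>A. \<exists>b\<in>B. Some a \<rightarrow>\<^sup>*\<^bsub>Z\<^esub> Some b)} \<union>
          {(Some A, None) |A. A \<in> comps \<and> (\<exists>a\<in>A. Some a \<rightarrow>\<^sup>*\<^bsub>Z\<^esub> None)}))"

subsection \<open>Block-triangular decomposition\<close>

text \<open>
  A block is a set of rows together with a set of vertices; the latter stands for all \<open>CARD('d)\<close>
  columns of each of its vertices. A permutation into block lower-triangular form with square
  diagonal blocks amounts to the list of the diagonal blocks, since the order of rows and vertices
  inside a block is immaterial.
\<close>

definition block_lower_triangular ::
  "real^('w::finite \<times> 'd::finite)^'e \<Rightarrow> 'e set \<Rightarrow> 'w set \<Rightarrow> ('e set \<times> 'w set) list \<Rightarrow> bool" where
  "block_lower_triangular M R W bs \<longleftrightarrow>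
     \<Union>(fst ` set bs) = R \<and> \<Union>(snd ` set bs) = W \<and>
     (\<forall>i<length bs. \<forall>j<length bs. i \<noteq> j \<longrightarrow>
        fst (bs ! i) \<inter> fst (bs ! j) = {} \<and> snd (bs ! i) \<inter> snd (bs ! j) = {}) \<and>
     (\<forall>(R', W')\<in>set bs. W' \<noteq> {} \<and> card R' = CARD('d) * card W') \<and>
     (\<forall>i j. i < j \<longrightarrow> j < length bs \<longrightarrow>
        (\<forall>e\<in>fst (bs ! i). \<forall>w\<in>snd (bs ! j). \<forall>k. M $ e $ (w, k) = 0))"

definition maximal_block_lower_triangular ::
  "real^('w::finite \<times> 'd::finite)^'e \<Rightarrow> 'e set \<Rightarrow> 'w set \<Rightarrow> ('e set \<times> 'w set) list \<Rightarrow> bool" where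
  "maximal_block_lower_triangular M R W bs \<longleftrightarrow>
     block_lower_triangular M R W bs \<and>
     (\<forall>(R', W')\<in>set bs. \<not> (\<exists>cs. block_lower_triangular M R' W' cs \<and> length cs \<ge> 2))"

definition block_arcs ::
  "('g, 'b) monoid_scheme \<Rightarrow> ('g \<Rightarrow> 'v \<Rightarrow> 'v) \<Rightarrow> 'v pinned_graph \<Rightarrow> ('v, 'g) gain_graph \<Rightarrow>
   ('v set set set \<times> 'v set set) list \<Rightarrow> ('v set set option) rel"
where
  "block_arcs S \<theta> G H bs =
     {(Some A, Some B) |R A R' B. (R, A) \<in> set bs \<and> (R', B) \<in> set bs \<and> A \<noteq> B \<and>
        (\<exists>e\<in>R. tail H e \<in> B \<or> head H e \<in> B)} \<union>
     {(Some A, None) |R A. (R, A) \<in> set bs \<and>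
        (\<exists>e\<in>R. tail H e \<in> pinned_orbits S \<theta> G \<or> head H e \<in> pinned_orbits S \<theta> G)}"

definition block_decomposition ::
  "('g, 'b) monoid_scheme \<Rightarrow> ('g \<Rightarrow> 'v \<Rightarrow> 'v) \<Rightarrow> 'v pinned_graph \<Rightarrow> ('v, 'g) gain_graph \<Rightarrow>
   ('v set set set \<times> 'v set set) list \<Rightarrow> 'v decomposition"
where
  "block_decomposition S \<theta> G H bs = (snd ` set bs, (block_arcs S \<theta> G H bs)\<^sup>+)"

end

(*
  Call a set U of inner orbits closed if no arc of the orientation leads from U to an inner orbit
  outside U. An orientation with all inner out-degrees equal to d has exactly d |U| arcs starting
  in U, so comparing cardinalities shows that both the unions of initially grounded components and
  the unions of leading diagonal blocks are closed: a square set of rows that all start in U must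
  consist of every row starting in U. Conversely, if U and the disjoint union of U and C are closed,
  then the rows starting in C and the columns of C form a diagonal block of an invertible
  block-triangular matrix, hence C can be grounded after U. At a regular realisation no row
  vanishes, and then a row is nonzero at each inner end of its edge, so that the zero pattern of
  the matrix is determined by the graph. Therefore the runs of the Assur procedure and the maximal
  block-triangular forms are chains of closed sets that cannot be refined, and the successive
  differences of such a chain are the strongly connected components.
*)

theory Submission
  imports Defs
begin

section \<open>Matrices with prescribed zero columns and rows\<close>

text \<open>The obstacle is that isostaticity of an extended component is not a statement about a
  submatrix of the matrix of \<open>G\<close>. It quantifies over every quotient of the component,
  with its own representatives, directions and gains, and over realisations that are regular for the
  component. The bridge is a velocity field on the vertices: a row applied to the coordinates of a
  symmetric field depends only on the field and on an edge of the orbit. A kernel vector for any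
  quotient of the component is spread over the orbits, which freeness permits, and read off again at
  the representatives of \<open>H\<close>. Realisations are handled by maximality: one that is
  regular for \<open>G\<close> is a symmetric realisation of the component, so its rank bounds the
  rank of a regular one from below. The three descriptions are not compared with each other
  directly. Each is related to \<open>connected_chain\<close>: the list itself is not unique, since
  incomparable components may be grounded in any order, but its components and their order are
  determined by the relation alone.\<close>

definition coordinate_space :: "'n set \<Rightarrow> (real^'n) set" where
  "coordinate_space J = {x. \<forall>i. i \<notin> J \<longrightarrow> x $ i = 0}"

lemma dim_coordinate_space: "dim (coordinate_space J) = card (J :: 'n::finite set)"
  using dim_substandard_cart[where 'a = real, of J] by (simp add: coordinate_space_def dim_vec_eq)

lemma subspace_coordinate_space: "subspace (coordinate_space J)"
  by (auto simp: coordinate_space_def subspace_def)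

text \<open>The orbit matrix is indexed by whole types and padded with zeros, so rank and
  injectivity are read on the coordinate subspace of the genuine columns instead of on a smaller
  matrix type.\<close>

lemma range_eq_image_coordinate_space:
  fixes M :: "real^'n^'m"
  assumes "\<And>e c. c \<notin> J \<Longrightarrow> M $ e $ c = 0"
  shows "range ((*v) M) = (*v) M ` coordinate_space J"
proof
  show "range ((*v) M) \<subseteq> (*v) M ` coordinate_space J"
  proof clarify
    fix x :: "real^'n"
    let ?y = "\<chi> i. if i \<in> J then x $ i else 0"
    have "M *v x = M *v ?y"
      by (auto simp: vec_eq_iff matrix_vector_mult_def assms intro!: sum.cong)
    moreover have "?y \<in> coordinate_space J" by (simp add: coordinate_space_def)
    ultimately show "M *v x \<in> (*v) M ` coordinate_space J" by blast
  qed
qed auto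

text \<open>Rank-nullity: a nonzero kernel vector extends to a basis of
  \<open>coordinate_space J\<close>, and its image contributes nothing, so the range would be
  spanned by fewer than \<open>card J\<close> vectors.\<close>

lemma kernel_trivial_if_rank_eq_card:
  fixes M :: "real^'n^'m"
  assumes "\<And>e c. c \<notin> J \<Longrightarrow> M $ e $ c = 0" and rk: "rank M = card J"
    and x: "x \<in> coordinate_space J" "M *v x = 0"
  shows "x = 0"
proof (rule ccontr)
  assume "x \<noteq> 0"
  then have "independent {x}" by simp
  then obtain B where B: "{x} \<subseteq> B" "B \<subseteq> coordinate_space J" "independent B"
      "coordinate_space J \<subseteq> span B"
    using maximal_independent_subset_extend[of "{x}" "coordinate_space J"] x(1) by blast
  have cB: "card B = card J"
    using B by (metis dim_coordinate_space dim_unique)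
  have fB: "finite B" using B(3) independent_bound by blast
  have lin: "linear ((*v) M)" by simp
  have "(*v) M ` coordinate_space J \<subseteq> span ((*v) M ` B)"
    using B(4) by (metis image_mono linear_span_image[OF lin])
  also have "span ((*v) M ` B) = span ((*v) M ` (B - {x}))"
  proof -
    have "(*v) M ` B = insert 0 ((*v) M ` (B - {x}))"
      using B(1) x(2) by (metis image_insert insert_Diff insert_subset)
    then show ?thesis by simp
  qed
  finally have "dim ((*v) M ` coordinate_space J) \<le> card ((*v) M ` (B - {x}))"
    using fB by (metis dim_le_card finite_Diff finite_imageI)
  also have "\<dots> \<le> card (B - {x})" using fB by (simp add: card_image_le)
  also have "\<dots> < card J" using B(1) fB cB by (metis card_Diff1_less insert_subset)
  finally show False
    using rk rank_dim_range[of M] range_eq_image_coordinate_space[of J M] assms(1) by simp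
qed

lemma card_le_rank_if_kernel_trivial:
  fixes M :: "real^'n^'m"
  assumes "\<And>x. x \<in> coordinate_space J \<Longrightarrow> M *v x = 0 \<Longrightarrow> x = 0"
  shows "card J \<le> rank M"
proof -
  have "inj_on ((*v) M) (coordinate_space J)"
    using assms by (subst linear_inj_on_iff_eq_0) (auto simp: subspace_coordinate_space)
  then have "dim ((*v) M ` coordinate_space J) = card J"
    by (simp add: dim_image_eq subspace_coordinate_space span_eq_iff[THEN iffD2]
        dim_coordinate_space)
  then show ?thesis
    by (metis dim_subset image_mono rank_dim_range top_greatest)
qed

lemma rank_le_card_columns:
  fixes M :: "real^'n^'m"
  assumes "\<And>e c. c \<notin> J \<Longrightarrow> M $ e $ c = 0"
  shows "rank M \<le> card J"
  using range_eq_image_coordinate_space[OF assms]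
  by (metis dim_coordinate_space dim_image_le matrix_vector_mul_linear rank_dim_range)

lemma rank_le_card_rows:
  fixes M :: "real^'n^'m"
  assumes "\<And>e c. e \<notin> R \<Longrightarrow> M $ e $ c = 0"
  shows "rank M \<le> card R"
proof -
  have "range ((*v) M) \<subseteq> coordinate_space R"
    by (auto simp: coordinate_space_def matrix_vector_mult_def assms)
  then show ?thesis by (metis dim_coordinate_space dim_subset rank_dim_range)
qed

text \<open>
  A square block of an injective matrix that is alone in its columns is invertible, so it can
  cancel every image in its rows.
\<close>

lemma in_coordinate_space_if_image:
  fixes M :: "real^'n^'m"
  assumes ker: "\<And>x. x \<in> coordinate_space J \<Longrightarrow> M *v x = 0 \<Longrightarrow> x = 0"
    and T: "T \<subseteq> J" "card T = card Q"
    and im: "\<And>x. x \<in> coordinate_space T \<Longrightarrow> M *v x \<in> coordinate_space Q"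
    and f: "f \<in> coordinate_space J" "M *v f \<in> coordinate_space Q"
  shows "f \<in> coordinate_space T"
proof -
  have TJ: "coordinate_space T \<subseteq> coordinate_space J" using T by (auto simp: coordinate_space_def)
  have "inj_on ((*v) M) (coordinate_space T)"
    using ker TJ by (subst linear_inj_on_iff_eq_0) (auto simp: subspace_coordinate_space)
  then have "dim ((*v) M ` coordinate_space T) = card Q"
    by (simp add: dim_image_eq subspace_coordinate_space span_eq_iff[THEN iffD2]
        dim_coordinate_space T)
  \<comment> \<open>An image of dimension \<open>card Q\<close> inside a space of that dimension
    fills it, so \<open>M *v f\<close> has a preimage supported on \<open>T\<close>; injectivity on
    \<open>J\<close> then identifies this preimage with \<open>f\<close>.\<close>
  then have "(*v) M ` coordinate_space T = coordinate_space Q"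
    by (intro subspace_dim_equal)
      (use im in \<open>auto simp: subspace_coordinate_space dim_coordinate_space
        intro!: linear_subspace_image\<close>)
  then obtain x where x: "x \<in> coordinate_space T" "M *v x = M *v f"
    using f(2) by (metis imageE)
  have "f - x \<in> coordinate_space J"
    using TJ f(1) x(1) by (auto intro!: subspace_diff subspace_coordinate_space)
  moreover have "M *v (f - x) = 0" using x(2) by (simp add: matrix_vector_mult_diff_distrib)
  ultimately have "f - x = 0" by (rule ker)
  then show ?thesis using x(1) by simp
qed

section \<open>Chains of strongly connected blocks\<close>

text \<open>A topological listing of the strongly connected components of \<open>r\<close>, sinks
  first. Connectedness of a block is expressed by the absence of a proper nonempty part closed
  inside it, because minimality of a groundable set and indecomposability of a diagonal block
  deliver it in that form.\<close>

definition connected_chain :: "'a rel \<Rightarrow> 'a set \<Rightarrow> 'a set list \<Rightarrow> bool" where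
  "connected_chain r W As \<longleftrightarrow>
     \<Union>(set As) = W \<and>
     (\<forall>i<length As. As ! i \<noteq> {} \<and> (\<forall>j<i. As ! i \<inter> As ! j = {}) \<and>
        r `` (As ! i) \<subseteq> \<Union>(set (take (Suc i) As)) \<and>
        (\<forall>X. X \<noteq> {} \<longrightarrow> X \<subset> As ! i \<longrightarrow> \<not> r `` X \<inter> As ! i \<subseteq> X))"

lemma in_Union_take_iff: "x \<in> \<Union>(set (take k As)) \<longleftrightarrow> (\<exists>j<length As. j < k \<and> x \<in> As ! j)"
  by (fastforce simp: in_set_conv_nth)

context
  fixes r :: "'a rel" and W :: "'a set" and As :: "'a set list"
  assumes ch: "connected_chain r W As"
begin

lemma chain_Union: "\<Union>(set As) = W" using ch by (simp add: connected_chain_def)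

lemma chain_index_unique:
  assumes "i < length As" "j < length As" "x \<in> As ! i" "x \<in> As ! j"
  shows "i = j"
proof -
  have "As ! k \<inter> As ! l = {}" if "l < k" "k < length As" for k l
    using ch that by (simp add: connected_chain_def)
  then show ?thesis using assms by (metis disjoint_iff linorder_neqE_nat)
qed

text \<open>Every arc stays in its block or enters an earlier one, so the block index never
  increases along a path.\<close>

lemma chain_rtrancl_index_le:
  assumes "(a, b) \<in> r\<^sup>*" "i < length As" "a \<in> As ! i"
  obtains j where "j \<le> i" "j < length As" "b \<in> As ! j"
proof -
  have "\<exists>j\<le>i. j < length As \<and> b \<in> As ! j"
    using assms(1)
  proof induction
    case base
    then show ?case using assms by blast
  next
    case (step y z)
    then obtain j where j: "j \<le> i" "j < length As" "y \<in> As ! j" by blast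
    have "r `` (As ! j) \<subseteq> \<Union>(set (take (Suc j) As))"
      using ch j(2) by (simp add: connected_chain_def)
    then have "z \<in> \<Union>(set (take (Suc j) As))" using step(2) j(3) by blast
    then show ?case using j(1) by (subst (asm) in_Union_take_iff) (auto simp: less_Suc_eq_le intro: le_trans)
  qed
  then show ?thesis using that by blast
qed

text \<open>The part of a block reachable from \<open>a\<close> is closed inside the block and
  contains \<open>a\<close>, so it cannot be proper.\<close>

lemma chain_strongly_connected:
  assumes "i < length As" "a \<in> As ! i" "b \<in> As ! i"
  shows "(a, b) \<in> r\<^sup>*"
proof (rule ccontr)
  assume nb: "(a, b) \<notin> r\<^sup>*"
  let ?X = "{c \<in> As ! i. (a, c) \<in> r\<^sup>*}"
  have "a \<in> ?X" "b \<notin> ?X" using assms nb by auto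
  then have "?X \<noteq> {}" "?X \<subset> As ! i" using assms(3) by blast+
  then have "\<not> r `` ?X \<inter> As ! i \<subseteq> ?X"
    using ch assms(1) by (simp add: connected_chain_def del: Collect_empty_eq)
  then show False by (auto intro: rtrancl_into_rtrancl)
qed

lemma chain_block_connected: "A \<in> set As \<Longrightarrow> a \<in> A \<Longrightarrow> b \<in> A \<Longrightarrow> (a, b) \<in> r\<^sup>*"
  using chain_strongly_connected by (metis in_set_conv_nth)

text \<open>Acyclicity of the condensation: paths in both directions make each of the two block
  indices at most the other.\<close>

lemma chain_rtrancl_blocks:
  assumes "(a, b) \<in> r\<^sup>*" "A \<in> set As" "B \<in> set As" "a \<in> A" "b \<in> B" "(b', a') \<in> r\<^sup>*"
    "b' \<in> B" "a' \<in> A"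
  shows "A = B"
proof -
  obtain i j where ij: "i < length As" "A = As ! i" "j < length As" "B = As ! j"
    using assms by (metis in_set_conv_nth)
  have "j \<le> i"
    using chain_rtrancl_index_le[OF assms(1) ij(1)] ij assms chain_index_unique by blast
  moreover have "i \<le> j"
    using chain_rtrancl_index_le[OF assms(6) ij(3)] ij assms chain_index_unique by blast
  ultimately show ?thesis using ij by simp
qed

lemma chain_blocks_disjoint:
  assumes "A \<in> set As" "B \<in> set As" "x \<in> A" "x \<in> B"
  shows "A = B"
  using chain_rtrancl_blocks[OF rtrancl_refl assms rtrancl_refl assms(4,3)] .

lemma chain_sccs:
  "set As = {C. C \<subseteq> W \<and> C \<noteq> {} \<and> (\<forall>a\<in>C. \<forall>b\<in>C. (a, b) \<in> r\<^sup>*) \<and>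
     (\<forall>a\<in>C. \<forall>b\<in>W - C. (a, b) \<notin> r\<^sup>* \<or> (b, a) \<notin> r\<^sup>*)}" (is "_ = ?sccs")
proof
  show sub: "set As \<subseteq> ?sccs"
  proof
    fix C assume C: "C \<in> set As"
    then obtain i where i: "i < length As" "C = As ! i" by (metis in_set_conv_nth)
    have "C \<noteq> {}" using ch i by (simp add: connected_chain_def)
    moreover have "(a, b) \<notin> r\<^sup>* \<or> (b, a) \<notin> r\<^sup>*" if ab: "a \<in> C" "b \<in> W - C" for a b
    proof -
      obtain B where B: "B \<in> set As" "b \<in> B" using ab(2) chain_Union by blast
      then show ?thesis using chain_rtrancl_blocks[of a b C B b a] C ab by blast
    qed
    moreover have "C \<subseteq> W" using C chain_Union by blast
    ultimately show "C \<in> ?sccs" using chain_block_connected[OF C] by simp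
  qed
  show "?sccs \<subseteq> set As"
  proof
    fix C assume "C \<in> ?sccs"
    then have CW: "C \<subseteq> W" "C \<noteq> {}"
      and conn: "\<And>a b. a \<in> C \<Longrightarrow> b \<in> C \<Longrightarrow> (a, b) \<in> r\<^sup>*"
      and max: "\<And>a b. a \<in> C \<Longrightarrow> b \<in> W - C \<Longrightarrow> (a, b) \<notin> r\<^sup>* \<or> (b, a) \<notin> r\<^sup>*"
      by simp_all
    obtain a where a: "a \<in> C" "a \<in> W" using CW by blast
    then obtain A where A: "A \<in> set As" "a \<in> A" using chain_Union by blast
    have "b \<in> C" if "b \<in> A" for b
    proof (rule ccontr)
      assume "b \<notin> C"
      then have "b \<in> W - C" using that A chain_Union by blast
      then show False using max[OF a(1)] chain_block_connected[OF A(1)] A(2) that by blast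
    qed
    moreover have "b \<in> A" if bC: "b \<in> C" for b
    proof -
      obtain B where B: "B \<in> set As" "b \<in> B" using bC CW(1) chain_Union by blast
      have "A = B"
        by (rule chain_rtrancl_blocks[OF conn[OF a(1) bC] A(1) B(1) A(2) B(2)
              conn[OF bC a(1)] B(2) A(2)])
      then show ?thesis using B(2) by simp
    qed
    ultimately have "C = A" by blast
    then show "C \<in> set As" using A by simp
  qed
qed

text \<open>\<open>P\<close> is the set of elements that are joined to the ground.\<close>

lemma chain_trancl:
  "({(Some A, Some B) |A B. A \<in> set As \<and> B \<in> set As \<and> A \<noteq> B \<and> (\<exists>a\<in>A. \<exists>b\<in>B. (a, b) \<in> r)} \<union>
    {(Some A, None) |A. A \<in> set As \<and> A \<inter> P \<noteq> {}})\<^sup>+ =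
   {(Some A, Some B) |A B. A \<in> set As \<and> B \<in> set As \<and> A \<noteq> B \<and> (\<exists>a\<in>A. \<exists>b\<in>B. (a, b) \<in> r\<^sup>*)} \<union>
    {(Some A, None) |A. A \<in> set As \<and> (\<exists>a\<in>A. \<exists>b\<in>P \<inter> W. (a, b) \<in> r\<^sup>*)}"
  (is "?T\<^sup>+ = ?R")
proof
  have in_T: "(Some A, Some B) \<in> ?T"
    if "A \<in> set As" "B \<in> set As" "A \<noteq> B" "a \<in> A" "b \<in> B" "(a, b) \<in> r" for A B a b
    using that by auto
  have in_R: "(Some A, Some B) \<in> ?R"
    if "A \<in> set As" "B \<in> set As" "A \<noteq> B" "a \<in> A" "b \<in> B" "(a, b) \<in> r\<^sup>*" for A B a b
    using that by auto
  have R_cases: thesis if "xy \<in> ?R"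
      "\<And>A B a b. xy = (Some A, Some B) \<Longrightarrow> A \<in> set As \<Longrightarrow> B \<in> set As \<Longrightarrow> A \<noteq> B \<Longrightarrow>
         a \<in> A \<Longrightarrow> b \<in> B \<Longrightarrow> (a, b) \<in> r\<^sup>* \<Longrightarrow> thesis"
      "\<And>A a b. xy = (Some A, None) \<Longrightarrow> A \<in> set As \<Longrightarrow> a \<in> A \<Longrightarrow> b \<in> P \<inter> W \<Longrightarrow>
         (a, b) \<in> r\<^sup>* \<Longrightarrow> thesis"
    for xy thesis
    using that(1) by (elim UnE CollectE exE conjE bexE) (use that(2,3) in auto)
  \<comment> \<open>Inside the middle block the two paths are linked by strong connectivity.
    Acyclicity keeps the composite from returning to its first block, which the condition
    \<open>A \<noteq> B\<close> would exclude.\<close>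
  have "trans ?R"
  proof (rule transI)
    fix x y z assume xy: "(x, y) \<in> ?R" and yz: "(y, z) \<in> ?R"
    show "(x, z) \<in> ?R"
    proof (rule R_cases[OF yz])
      fix B C b' c
      assume yz: "(y, z) = (Some B, Some C)" "B \<in> set As" "C \<in> set As" "B \<noteq> C"
        "b' \<in> B" "c \<in> C" "(b', c) \<in> r\<^sup>*"
      then obtain A a b where A: "x = Some A" "A \<in> set As" "A \<noteq> B" "a \<in> A" "b \<in> B"
          "(a, b) \<in> r\<^sup>*"
        using R_cases[OF xy] by auto
      have bc: "(b, c) \<in> r\<^sup>*"
        using chain_block_connected[OF yz(2) A(5) yz(5)] yz(7) by (rule rtrancl_trans)
      have "A \<noteq> C"
        using chain_rtrancl_blocks[OF A(6) A(2) yz(2) A(4,5) bc A(5)] yz(6) A(3) by auto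
      then show ?thesis
        using in_R[OF A(2) yz(3) _ A(4) yz(6) rtrancl_trans[OF A(6) bc]] A(1) yz(1) by simp
    next
      fix B b' c
      assume yz: "(y, z) = (Some B, None)" "B \<in> set As" "b' \<in> B" "c \<in> P \<inter> W" "(b', c) \<in> r\<^sup>*"
      from xy obtain A a b where A: "x = Some A" "A \<in> set As" "a \<in> A" "b \<in> B" "(a, b) \<in> r\<^sup>*"
        by (rule R_cases) (use yz(1) in auto)
      have "(b, c) \<in> r\<^sup>*"
        using chain_block_connected[OF yz(2) A(4) yz(3)] yz(5) by (rule rtrancl_trans)
      then have "(a, c) \<in> r\<^sup>*" using A(5) by (rule rtrancl_trans[rotated])
      then show ?thesis using A yz(1,4) by auto
    qed
  qed
  moreover have "?T \<subseteq> ?R" using chain_Union by fastforce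
  ultimately show "?T\<^sup>+ \<subseteq> ?R" by (metis (no_types, lifting) trancl_id trancl_mono_subset)
  \<comment> \<open>For the converse a path is cut where it changes blocks. Steps inside a block
    yield no pair of the relation, hence the alternative \<open>A = B\<close>.\<close>
  have path: "\<exists>B\<in>set As. b \<in> B \<and> (A = B \<or> (Some A, Some B) \<in> ?T\<^sup>+)"
    if ab: "(a, b) \<in> r\<^sup>*" "A \<in> set As" "a \<in> A" for a b A
    using ab(1)
  proof induction
    case base
    then show ?case using ab(2,3) by auto
  next
    case (step y z)
    then obtain B where B: "B \<in> set As" "y \<in> B" "A = B \<or> (Some A, Some B) \<in> ?T\<^sup>+" by auto
    obtain i where i: "i < length As" "y \<in> As ! i" using B(1,2) by (metis in_set_conv_nth)
    obtain j where "j < length As" "z \<in> As ! j"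
      using chain_rtrancl_index_le[OF r_into_rtrancl[OF step(2)] i] by metis
    then obtain C where C: "C \<in> set As" "z \<in> C" by (metis nth_mem)
    have "B = C \<or> (Some B, Some C) \<in> ?T" using in_T[OF B(1) C(1) _ B(2) C(2) step(2)] by argo
    then have "A = C \<or> (Some A, Some C) \<in> ?T\<^sup>+"
      using B(3) trancl_into_trancl[of "Some A" "Some B" ?T "Some C"] r_into_trancl[of _ ?T]
      by fast
    then show ?case using C by auto
  qed
  show "?R \<subseteq> ?T\<^sup>+"
  proof
    fix xy assume "xy \<in> ?R"
    then show "xy \<in> ?T\<^sup>+"
    proof (rule R_cases)
      fix A B a b
      assume AB: "xy = (Some A, Some B)" "A \<in> set As" "B \<in> set As" "A \<noteq> B"
        "a \<in> A" "b \<in> B" "(a, b) \<in> r\<^sup>*"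
      obtain B' where B': "B' \<in> set As" "b \<in> B'" "A = B' \<or> (Some A, Some B') \<in> ?T\<^sup>+"
        using path[OF AB(7,2,5)] by (elim bexE conjE)
      then show ?thesis using chain_blocks_disjoint[OF B'(1) AB(3) B'(2) AB(6)] AB(1,4) by argo
    next
      fix A a b
      assume A: "xy = (Some A, None)" "A \<in> set As" "a \<in> A" "b \<in> P \<inter> W" "(a, b) \<in> r\<^sup>*"
      obtain B where B: "B \<in> set As" "b \<in> B" "A = B \<or> (Some A, Some B) \<in> ?T\<^sup>+"
        using path[OF A(5,2,3)] by (elim bexE conjE)
      have "(Some B, None) \<in> ?T" using B A(4) by auto
      then show ?thesis
        using B(3) A(1) trancl_into_trancl[of "Some A" "Some B" ?T None] r_into_trancl[of _ ?T]
        by fast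
    qed
  qed
qed

end

section \<open>Oriented quotient graphs\<close>

locale oriented_quotient =
  fixes S :: "('g, 'b) monoid_scheme"
    and \<theta> :: "'g \<Rightarrow> 'v::finite \<Rightarrow> 'v"
    and \<tau> :: "'g \<Rightarrow> real^'d^'d"
    and G :: "'v pinned_graph"
    and H :: "('v, 'g) gain_graph"
    and D :: "('v set, 'v set set) pre_digraph"
  assumes group_S: "group S"
    and pinned_graph_G: "pinned_graph G"
    and acts: "acts_on_pinned_graph S \<theta> G"
    and free_action: "free_on_vertices S \<theta> G"
    and tau_hom: "\<tau> \<in> hom S orthogonal_group"
    and quotient_H: "quotient_gain_graph S \<theta> G H"
    and orientation_D: "directed_orientation CARD('d) S \<theta> G H D"
begin

abbreviation V :: "'v set" where "V \<equiv> inner G \<union> pinned G"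
abbreviation W :: "'v set set" where "W \<equiv> inner_orbits S \<theta> G"
abbreviation Pins :: "'v set set" where "Pins \<equiv> pinned_orbits S \<theta> G"

definition out :: "'v set set \<Rightarrow> 'v set set set" where
  "out X = {e \<in> arcs D. tail D e \<in> X}"

text \<open>Arcs into pins are left out: pins are grounded from the start and never obstruct
  closedness. They return in \<open>to_pins\<close>, where the order relative to the ground is
  described.\<close>

definition arc_rel :: "'v set rel" where
  "arc_rel = {(tail D e, head D e) |e. e \<in> arcs D \<and> head D e \<in> W}"

sublocale act: group_action S V \<theta>
  using acts by (simp add: acts_on_pinned_graph_def)

sublocale group S by (rule group_S)

section \<open>Vertex orbits as a partition\<close>

lemma act_V: "x \<in> carrier S \<Longrightarrow> v \<in> V \<Longrightarrow> \<theta> x v \<in> V"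
  using act.element_image by blast

lemma act_one: "v \<in> V \<Longrightarrow> \<theta> \<one>\<^bsub>S\<^esub> v = v"
  using act.id_eq_one by (metis restrict_apply')

lemma act_inner: "x \<in> carrier S \<Longrightarrow> v \<in> inner G \<Longrightarrow> \<theta> x v \<in> inner G"
  and act_pinned: "x \<in> carrier S \<Longrightarrow> v \<in> pinned G \<Longrightarrow> \<theta> x v \<in> pinned G"
  and act_edges: "x \<in> carrier S \<Longrightarrow> e \<in> edges G \<Longrightarrow> \<theta> x ` e \<in> edges G"
  using acts unfolding acts_on_pinned_graph_def by blast+

lemma inner_pinned_disjoint: "inner G \<inter> pinned G = {}"
  using pinned_graph_G by (simp add: pinned_graph_def)

lemma edge_subset: "e \<in> edges G \<Longrightarrow> e \<subseteq> V"
  using pinned_graph_G by (auto simp: pinned_graph_def)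

lemma orbit_self: "v \<in> V \<Longrightarrow> v \<in> orbit S \<theta> v"
  by (rule act.orbit_refl)

lemma orbit_act:
  assumes x: "x \<in> carrier S" and v: "v \<in> V"
  shows "orbit S \<theta> (\<theta> x v) = orbit S \<theta> v"
proof
  show "orbit S \<theta> (\<theta> x v) \<subseteq> orbit S \<theta> v"
  proof
    fix u assume "u \<in> orbit S \<theta> (\<theta> x v)"
    then obtain g where "g \<in> carrier S" "u = \<theta> g (\<theta> x v)" by (auto simp: orbit_def)
    then have "g \<otimes>\<^bsub>S\<^esub> x \<in> carrier S" "u = \<theta> (g \<otimes>\<^bsub>S\<^esub> x) v"
      using act.composition_rule[OF v, of g x] x by simp_all
    then show "u \<in> orbit S \<theta> v" by (auto simp: orbit_def)
  qed
  show "orbit S \<theta> v \<subseteq> orbit S \<theta> (\<theta> x v)"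
  proof
    fix u assume "u \<in> orbit S \<theta> v"
    then obtain g where "g \<in> carrier S" "u = \<theta> g v" by (auto simp: orbit_def)
    then have "g \<otimes>\<^bsub>S\<^esub> inv\<^bsub>S\<^esub> x \<in> carrier S" "u = \<theta> (g \<otimes>\<^bsub>S\<^esub> inv\<^bsub>S\<^esub> x) (\<theta> x v)"
      using act.composition_rule[OF v, of "g \<otimes>\<^bsub>S\<^esub> inv\<^bsub>S\<^esub> x" x] x by (simp_all add: m_assoc)
    then show "u \<in> orbit S \<theta> (\<theta> x v)" by (auto simp: orbit_def)
  qed
qed

lemma orbit_eq:
  assumes "v \<in> V" "u \<in> orbit S \<theta> v"
  shows "orbit S \<theta> u = orbit S \<theta> v"
proof -
  obtain x where "x \<in> carrier S" "u = \<theta> x v" using assms(2) by (auto simp: orbit_def)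
  then show ?thesis using orbit_act[OF _ assms(1)] by simp
qed

lemma inner_orbit_subset: "w \<in> W \<Longrightarrow> w \<subseteq> inner G"
  and pinned_orbit_subset: "w \<in> Pins \<Longrightarrow> w \<subseteq> pinned G"
  using act_inner act_pinned by (auto simp: orbits_def orbit_def)

lemma Union_pinned_orbits: "\<Union>Pins = pinned G"
proof
  show "pinned G \<subseteq> \<Union>Pins" using orbit_self by (auto simp: orbits_def)
qed (use pinned_orbit_subset in blast)

lemma verts_H: "verts H = W \<union> Pins" and arcs_H: "arcs H = edge_orbits S \<theta> G"
  and rep_in: "w \<in> verts H \<Longrightarrow> rep H w \<in> w"
  and tail_H: "e \<in> arcs H \<Longrightarrow> tail H e \<in> verts H"
  and head_H: "e \<in> arcs H \<Longrightarrow> head H e \<in> verts H"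
  using quotient_H by (auto simp: quotient_gain_graph_def)

lemma orbit_of_member:
  assumes "w \<in> W \<union> Pins" "v \<in> w"
  shows "w = orbit S \<theta> v" "v \<in> V"
proof -
  obtain u where u: "u \<in> V" "w = orbit S \<theta> u" using assms(1) by (auto simp: orbits_def)
  then show "w = orbit S \<theta> v" using orbit_eq assms(2) by metis
  show "v \<in> V" using assms inner_orbit_subset pinned_orbit_subset by blast
qed

lemma in_Union_orbits_iff:
  assumes "w \<in> W \<union> Pins" "v \<in> w" "X \<subseteq> W \<union> Pins"
  shows "v \<in> \<Union>X \<longleftrightarrow> w \<in> X"
proof
  assume "v \<in> \<Union>X"
  then obtain w' where w': "w' \<in> X" "v \<in> w'" by blast
  then have "w' = w" using orbit_of_member(1)[OF assms(1,2)] orbit_of_member(1)[of w' v] assms(3) by auto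
  then show "w \<in> X" using w' by simp
qed (use assms(2) in blast)

lemma orbits_disjoint: "W \<inter> Pins = {}"
proof -
  have "w \<noteq> {}" if "w \<in> W" for w
    using that orbit_self by (auto simp: orbits_def)
  then show ?thesis using inner_orbit_subset pinned_orbit_subset inner_pinned_disjoint by fastforce
qed

section \<open>Edge orbits and their ends\<close>

lemma edge_orbit_subset: "\<epsilon> \<in> edge_orbits S \<theta> G \<Longrightarrow> \<epsilon> \<subseteq> edges G"
  using act_edges by (auto simp: orbits_def orbit_def)

lemma image_act_one: "e \<in> edges G \<Longrightarrow> \<theta> \<one>\<^bsub>S\<^esub> ` e = e"
  using edge_subset[of e] act_one by (auto simp: image_def subset_iff)

lemma image_act_mult:
  assumes "x \<in> carrier S" "y \<in> carrier S" "e \<in> edges G"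
  shows "\<theta> (x \<otimes>\<^bsub>S\<^esub> y) ` e = \<theta> x ` (\<theta> y ` e)"
proof -
  have "\<theta> (x \<otimes>\<^bsub>S\<^esub> y) v = \<theta> x (\<theta> y v)" if "v \<in> e" for v
    using act.composition_rule[OF _ assms(1,2)] edge_subset[OF assms(3)] that by blast
  then show ?thesis unfolding image_image by (intro image_cong) auto
qed

abbreviation edge_orbit :: "'v set \<Rightarrow> 'v set set" where
  "edge_orbit e \<equiv> orbit S (\<lambda>x e. \<theta> x ` e) e"

lemma edge_orbit_self: "e \<in> edges G \<Longrightarrow> e \<in> edge_orbit e"
  using image_act_one by (auto simp: orbit_def intro!: exI[of _ "\<one>\<^bsub>S\<^esub>"])

lemma edge_orbit_in: "e \<in> edges G \<Longrightarrow> edge_orbit e \<in> edge_orbits S \<theta> G"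
  by (auto simp: orbits_def)

lemma edge_orbit_eq:
  assumes "\<epsilon> \<in> edge_orbits S \<theta> G" "e \<in> \<epsilon>"
  shows "edge_orbit e = \<epsilon>"
proof -
  obtain e' where e': "e' \<in> edges G" "\<epsilon> = edge_orbit e'" using assms(1) by (auto simp: orbits_def)
  then obtain x where x: "x \<in> carrier S" "e = \<theta> x ` e'" using assms(2) by (auto simp: orbit_def)
  show ?thesis
  proof (intro equalityI subsetI)
    fix f assume "f \<in> edge_orbit e"
    then obtain g where g: "g \<in> carrier S" "f = \<theta> g ` e" by (auto simp: orbit_def)
    then have "f = \<theta> (g \<otimes>\<^bsub>S\<^esub> x) ` e'" using image_act_mult[OF g(1) x(1) e'(1)] x(2) by simp
    then show "f \<in> \<epsilon>" using g(1) x(1) e'(2) by (auto simp: orbit_def)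
  next
    fix f assume "f \<in> \<epsilon>"
    then obtain g where g: "g \<in> carrier S" "f = \<theta> g ` e'" using e'(2) by (auto simp: orbit_def)
    then have "f = \<theta> (g \<otimes>\<^bsub>S\<^esub> inv\<^bsub>S\<^esub> x) ` e"
      using image_act_mult[of "g \<otimes>\<^bsub>S\<^esub> inv\<^bsub>S\<^esub> x" x e'] x e'(1) by (simp add: m_assoc)
    then show "f \<in> edge_orbit e" using g(1) x(1) by (auto simp: orbit_def)
  qed
qed

lemma edge_cases:
  assumes "\<epsilon> \<in> arcs H" "e \<in> \<epsilon>"
  obtains a b where "e = {a, b}" "a \<in> tail H \<epsilon>" "b \<in> head H \<epsilon>"
proof -
  have gain: "gain H \<epsilon> \<in> carrier S" and
    eps: "\<epsilon> = {{\<theta> x (rep H (tail H \<epsilon>)), \<theta> (x \<otimes>\<^bsub>S\<^esub> gain H \<epsilon>) (rep H (head H \<epsilon>))} |x. x \<in> carrier S}"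
    using quotient_H assms(1) unfolding quotient_gain_graph_def by blast+
  obtain x where x: "x \<in> carrier S"
    "e = {\<theta> x (rep H (tail H \<epsilon>)), \<theta> (x \<otimes>\<^bsub>S\<^esub> gain H \<epsilon>) (rep H (head H \<epsilon>))}"
    using subsetD[OF equalityD1[OF eps] assms(2)] by blast
  have in_orbit: "\<theta> g (rep H w) \<in> w" if "g \<in> carrier S" "w \<in> verts H" for g w
  proof -
    have "w = orbit S \<theta> (rep H w)" using orbit_of_member rep_in that(2) verts_H by blast
    then show ?thesis using that(1) by (auto simp: orbit_def)
  qed
  show ?thesis
    using that[OF x(2)] in_orbit x(1) gain tail_H[OF assms(1)] head_H[OF assms(1)] by simp
qed

section \<open>The orientation and the counting of outgoing arcs\<close>

lemma arcs_D: "arcs D = arcs H"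
  and out_degree_inner: "w \<in> W \<Longrightarrow> out_degree D w = CARD('d)"
  and out_degree_pinned: "w \<in> Pins \<Longrightarrow> out_degree D w = 0"
  and ends_D: "e \<in> arcs H \<Longrightarrow> tail D e = tail H e \<and> head D e = head H e \<or>
    tail D e = head H e \<and> head D e = tail H e"
  using orientation_D by (auto simp: directed_orientation_def)

text \<open>An arc leaving a pinned orbit would be counted by its out-degree. All sets of arcs are
  finite here, so out-degree zero really means that no arc leaves.\<close>

lemma tail_D: "e \<in> arcs H \<Longrightarrow> tail D e \<in> W"
proof (rule ccontr)
  assume e: "e \<in> arcs H" "tail D e \<notin> W"
  then have "tail D e \<in> Pins" using ends_D[of e] tail_H[of e] head_H[of e] verts_H by auto
  then have "out_arcs D (tail D e) = {}" using out_degree_pinned by (simp add: out_degree_def)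
  then show False using e arcs_D by (auto simp: out_arcs_def)
qed

lemma head_D: "e \<in> arcs H \<Longrightarrow> head D e \<in> W \<union> Pins"
  using ends_D[of e] tail_H[of e] head_H[of e] verts_H by auto

lemma edge_subset_iff:
  assumes "\<epsilon> \<in> arcs H" "e \<in> \<epsilon>" "X \<subseteq> W \<union> Pins"
  shows "e \<subseteq> \<Union>X \<longleftrightarrow> tail D \<epsilon> \<in> X \<and> head D \<epsilon> \<in> X"
    and "e \<inter> \<Union>X \<noteq> {} \<longleftrightarrow> tail D \<epsilon> \<in> X \<or> head D \<epsilon> \<in> X"
proof -
  obtain a b where ab: "e = {a, b}" "a \<in> tail H \<epsilon>" "b \<in> head H \<epsilon>"
    using edge_cases[OF assms(1,2)] by metis
  have "a \<in> \<Union>X \<longleftrightarrow> tail H \<epsilon> \<in> X"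
    using in_Union_orbits_iff[OF _ ab(2) assms(3)] tail_H[OF assms(1)] verts_H by blast
  moreover have "b \<in> \<Union>X \<longleftrightarrow> head H \<epsilon> \<in> X"
    using in_Union_orbits_iff[OF _ ab(3) assms(3)] head_H[OF assms(1)] verts_H by blast
  ultimately show "e \<subseteq> \<Union>X \<longleftrightarrow> tail D \<epsilon> \<in> X \<and> head D \<epsilon> \<in> X"
    and "e \<inter> \<Union>X \<noteq> {} \<longleftrightarrow> tail D \<epsilon> \<in> X \<or> head D \<epsilon> \<in> X"
    using ends_D[OF assms(1)] unfolding ab(1) by auto
qed

lemma card_out: "X \<subseteq> W \<Longrightarrow> card (out X) = CARD('d) * card X"
proof -
  assume X: "X \<subseteq> W"
  have "out X = (\<Union>w\<in>X. out_arcs D w)" by (auto simp: out_def out_arcs_def)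
  also have "card \<dots> = (\<Sum>w\<in>X. card (out_arcs D w))"
    by (rule card_UN_disjoint) (auto simp: out_arcs_def)
  also have "\<dots> = (\<Sum>w\<in>X. CARD('d))"
    using X out_degree_inner by (intro sum.cong) (auto simp: out_degree_def)
  finally show ?thesis by simp
qed

lemma eq_out_if_card:
  assumes "X \<subseteq> W" "R \<subseteq> out X" "card R = CARD('d) * card X"
  shows "R = out X"
  using card_subset_eq[OF _ assms(2)] card_out[OF assms(1)] assms(3) by simp

lemma out_W: "out W = arcs H"
  using tail_D arcs_D by (auto simp: out_def)

lemma arc_rel_closed_iff:
  assumes "Y \<subseteq> W"
  shows "arc_rel `` X \<subseteq> Y \<longleftrightarrow> (\<forall>e\<in>out X. head D e \<in> Y \<union> Pins)"
proof
  assume closed: "arc_rel `` X \<subseteq> Y"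
  show "\<forall>e\<in>out X. head D e \<in> Y \<union> Pins"
  proof
    fix e assume e: "e \<in> out X"
    then have "head D e \<in> W \<union> Pins" using head_D arcs_D by (simp add: out_def)
    moreover have "head D e \<in> Y" if "head D e \<in> W"
      using closed e that by (auto simp: arc_rel_def out_def)
    ultimately show "head D e \<in> Y \<union> Pins" by blast
  qed
next
  assume "\<forall>e\<in>out X. head D e \<in> Y \<union> Pins"
  then show "arc_rel `` X \<subseteq> Y" using orbits_disjoint by (auto simp: arc_rel_def out_def)
qed

lemma orbits_Union:
  assumes "C \<subseteq> W" shows "orbits S (\<Union>C) \<theta> = C"
proof -
  have "orbit S \<theta> v = w" if "w \<in> C" "v \<in> w" for v w
    using orbit_of_member[of w v] that assms by blast
  moreover have "w \<noteq> {}" if "w \<in> C" for w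
    using that assms orbit_self by (auto simp: orbits_def)
  ultimately show ?thesis by (fastforce simp: orbits_def)
qed

lemma edges_eq_Union:
  assumes "F \<subseteq> edges G" "\<And>x e. x \<in> carrier S \<Longrightarrow> e \<in> F \<Longrightarrow> \<theta> x ` e \<in> F"
  shows "\<Union>(orbits S F (\<lambda>x e. \<theta> x ` e)) = F"
proof
  show "F \<subseteq> \<Union>(orbits S F (\<lambda>x e. \<theta> x ` e))"
    using edge_orbit_self assms(1) by (auto simp: orbits_def)
qed (use assms(2) in \<open>auto simp: orbits_def orbit_def\<close>)

subsection \<open>Extended components\<close>

lemma inner_extended: "inner (extended_component G U C) = \<Union>C"
  by (simp add: extended_component_def Let_def)

lemma edges_extended:
  "edges (extended_component G U C) =
     {e \<in> edges G. e \<inter> \<Union>C \<noteq> {} \<and> e \<subseteq> \<Union>(C \<union> U \<union> Pins)}"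
  by (simp add: extended_component_def Let_def Union_pinned_orbits)

lemma pinned_extended:
  "pinned (extended_component G U C) = \<Union>(edges (extended_component G U C)) - \<Union>C"
  by (simp add: extended_component_def Let_def)

text \<open>Whether an edge belongs to the extended component is decided by the orbits of its two
  ends, so the answer is constant on each edge orbit and can be read off the arc.\<close>

lemma edge_orbits_extended:
  assumes "C \<subseteq> W" "U \<subseteq> W"
  shows "edge_orbits S \<theta> (extended_component G U C) =
    {\<epsilon> \<in> arcs H. (tail D \<epsilon> \<in> C \<or> head D \<epsilon> \<in> C) \<and>
       tail D \<epsilon> \<in> C \<union> U \<union> Pins \<and> head D \<epsilon> \<in> C \<union> U \<union> Pins}" (is "?L = ?R")
proof -
  have sub: "C \<subseteq> W \<union> Pins" "C \<union> U \<union> Pins \<subseteq> W \<union> Pins" using assms by auto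
  have iff: "e \<in> edges (extended_component G U C) \<longleftrightarrow> \<epsilon> \<in> ?R" if "\<epsilon> \<in> arcs H" "e \<in> \<epsilon>" for e \<epsilon>
    unfolding edges_extended
    using edge_subset_iff(2)[OF that sub(1)] edge_subset_iff(1)[OF that sub(2)]
      edge_orbit_subset that arcs_H by blast
  show ?thesis
  proof (intro equalityI subsetI)
    fix \<epsilon> assume "\<epsilon> \<in> ?L"
    then obtain e where e: "e \<in> edges (extended_component G U C)" "\<epsilon> = edge_orbit e"
      by (auto simp: orbits_def)
    then have "e \<in> edges G" by (simp add: edges_extended)
    then show "\<epsilon> \<in> ?R" using iff[of \<epsilon> e] e edge_orbit_in edge_orbit_self arcs_H by simp
  next
    fix \<epsilon> assume R: "\<epsilon> \<in> ?R"
    then obtain e where e: "e \<in> \<epsilon>" using arcs_H edge_orbit_self by (fastforce simp: orbits_def)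
    then have "e \<in> edges (extended_component G U C)" using iff[of \<epsilon> e] R by simp
    moreover have "\<epsilon> = edge_orbit e" using edge_orbit_eq[of \<epsilon> e] R e arcs_H by simp
    ultimately show "\<epsilon> \<in> ?L" by (auto simp: orbits_def)
  qed
qed

text \<open>An arc starting in \<open>U\<close> ends in \<open>U\<close> or at a pin, and no arc
  starts at a pin, so an edge that touches \<open>C\<close> must start in \<open>C\<close>.\<close>

lemma edge_orbits_extended_subset_out:
  assumes "C \<subseteq> W - U" "U \<subseteq> W" "arc_rel `` U \<subseteq> U"
  shows "edge_orbits S \<theta> (extended_component G U C) \<subseteq> out C"
proof
  fix \<epsilon> assume "\<epsilon> \<in> edge_orbits S \<theta> (extended_component G U C)"
  then have e: "\<epsilon> \<in> arcs H" "tail D \<epsilon> \<in> C \<or> head D \<epsilon> \<in> C" "tail D \<epsilon> \<in> C \<union> U"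
    using edge_orbits_extended[of C U] assms tail_D orbits_disjoint by blast+
  have "tail D \<epsilon> \<in> C"
  proof (rule ccontr)
    assume "tail D \<epsilon> \<notin> C"
    then have "\<epsilon> \<in> out U" "head D \<epsilon> \<in> C" using e arcs_D by (auto simp: out_def)
    then have "head D \<epsilon> \<in> U \<union> Pins" using arc_rel_closed_iff[of U U] assms(2,3) by simp
    then show False using \<open>head D \<epsilon> \<in> C\<close> assms orbits_disjoint by blast
  qed
  then show "\<epsilon> \<in> out C" using e arcs_D by (auto simp: out_def)
qed

lemma edge_orbits_extended_eq_out:
  assumes "C \<subseteq> W - U" "U \<subseteq> W" "arc_rel `` U \<subseteq> U" "arc_rel `` (U \<union> C) \<subseteq> U \<union> C"
  shows "edge_orbits S \<theta> (extended_component G U C) = out C"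
proof
  show "out C \<subseteq> edge_orbits S \<theta> (extended_component G U C)"
  proof
    fix \<epsilon> assume e: "\<epsilon> \<in> out C"
    then have "\<epsilon> \<in> out (U \<union> C)" by (simp add: out_def)
    then have "head D \<epsilon> \<in> U \<union> C \<union> Pins"
      using arc_rel_closed_iff[of "U \<union> C" "U \<union> C"] assms by auto
    then show "\<epsilon> \<in> edge_orbits S \<theta> (extended_component G U C)"
      using edge_orbits_extended[of C U] assms(1,2) e arcs_D by (auto simp: out_def)
  qed
qed (rule edge_orbits_extended_subset_out[OF assms(1-3)])

lemma inner_orbits_extended: "C \<subseteq> W \<Longrightarrow> inner_orbits S \<theta> (extended_component G U C) = C"
  by (simp add: inner_extended orbits_Union)

text \<open>The edge count in isostaticity forces every arc of \<open>out C\<close> into the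
  extended component, and that component admits only edges with both ends in \<open>C\<close>, in
  \<open>U\<close> or among the pins. Hence no arc of \<open>C\<close> escapes.\<close>

lemma groundable_imp_closed:
  assumes "groundable S \<theta> \<tau> G U C" "U \<subseteq> W" "arc_rel `` U \<subseteq> U"
  shows "arc_rel `` (U \<union> C) \<subseteq> U \<union> C"
proof -
  have C: "C \<subseteq> W - U" and
    iso: "pinned_isostatic S \<theta> \<tau> (extended_component G U C)"
    using assms(1) by (auto simp: groundable_def)
  have CW: "C \<subseteq> W" using C by blast
  have "edge_orbits S \<theta> (extended_component G U C) = out C"
    using eq_out_if_card[OF CW edge_orbits_extended_subset_out[OF C assms(2,3)]] iso
    by (simp add: pinned_isostatic_def inner_orbits_extended[OF CW])
  then have "\<forall>\<epsilon>\<in>out C. head D \<epsilon> \<in> U \<union> C \<union> Pins"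
    using edge_orbits_extended[OF CW assms(2)] by blast
  then have "arc_rel `` C \<subseteq> U \<union> C" using arc_rel_closed_iff[of "U \<union> C" C] CW assms(2) by simp
  then show ?thesis using assms(3) by blast
qed

end

section \<open>Rows of the pinned orbit matrix\<close>

lemma matrix_inv_orthogonal:
  fixes A :: "real^'n^'n"
  assumes "orthogonal_matrix A"
  shows "matrix_inv A = transpose A"
proof -
  have A: "A ** transpose A = mat 1" "transpose A ** A = mat 1"
    using assms by (auto simp: orthogonal_matrix_def)
  then have "A ** matrix_inv A = mat 1" unfolding matrix_inv_def by (metis (mono_tags, lifting) someI_ex)
  then have "transpose A ** (A ** matrix_inv A) = transpose A" by simp
  then show ?thesis by (simp add: matrix_mul_assoc A)
qed

lemma inner_transpose_mult:
  fixes A :: "real^'n^'n"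
  shows "(transpose A *v x) \<bullet> y = x \<bullet> (A *v y)"
  by (simp add: dot_lmul_matrix)

lemma inner_orthogonal_mult:
  fixes A :: "real^'n^'n"
  assumes "orthogonal_matrix A"
  shows "(A *v x) \<bullet> (A *v y) = x \<bullet> y"
proof -
  have "(A *v x) \<bullet> (A *v y) = (transpose A *v (A *v x)) \<bullet> y" by (simp only: inner_transpose_mult)
  then show ?thesis using assms by (simp add: matrix_vector_mul_assoc orthogonal_matrix_def)
qed

lemma orbit_entry_eq_0:
  "w \<noteq> tail H e \<Longrightarrow> w \<noteq> head H e \<Longrightarrow> orbit_entry \<tau> H q e w = 0"
  by (simp add: orbit_entry_def Let_def)

text \<open>This covers ordinary edges, loops and edges to pins by one formula. A pin has no
  columns, which is harmless as long as \<open>F\<close> vanishes there.\<close>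

lemma sum_orbit_entry:
  fixes q F :: "'v set \<Rightarrow> real^'d" and A :: "real^'d^'d"
  assumes A: "orthogonal_matrix (\<tau> (gain H e))" and fin: "finite X"
    and F: "\<And>w. w \<in> {tail H e, head H e} \<Longrightarrow> w \<notin> X \<Longrightarrow> F w = 0"
  shows "(\<Sum>w\<in>X. orbit_entry \<tau> H q e w \<bullet> F w) =
    (q (tail H e) - \<tau> (gain H e) *v q (head H e)) \<bullet>
    (F (tail H e) - \<tau> (gain H e) *v F (head H e))"
proof -
  let ?u = "tail H e" and ?v = "head H e" and ?A = "\<tau> (gain H e)"
  have inv: "matrix_inv ?A = transpose ?A" by (rule matrix_inv_orthogonal[OF A])
  have "(\<Sum>w\<in>X. orbit_entry \<tau> H q e w \<bullet> F w) = (\<Sum>w\<in>{?u, ?v}. orbit_entry \<tau> H q e w \<bullet> F w)"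
    using fin F by (intro sum.mono_neutral_cong) (auto simp: orbit_entry_eq_0)
  also have "\<dots> = (q ?u - ?A *v q ?v) \<bullet> (F ?u - ?A *v F ?v)"
  proof (cases "?u = ?v")
    case True
    then have "(\<Sum>w\<in>{?u, ?v}. orbit_entry \<tau> H q e w \<bullet> F w) =
      (2 *\<^sub>R q ?u - ?A *v q ?u - transpose ?A *v q ?u) \<bullet> F ?u"
      by (simp add: orbit_entry_def Let_def inv)
    \<comment> \<open>When the product is expanded, orthogonality turns the product of the two
      images under \<open>?A\<close> into a second copy of the plain product; this is the origin of
      the coefficient 2 in the loop entry.\<close>
    also have "\<dots> = (q ?u - ?A *v q ?u) \<bullet> (F ?u - ?A *v F ?u)"
      by (simp add: inner_diff_left inner_diff_right inner_transpose_mult inner_orthogonal_mult[OF A]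
          del: transpose_matrix_vector)
    finally show ?thesis using True by simp
  next
    case False
    then have "(\<Sum>w\<in>{?u, ?v}. orbit_entry \<tau> H q e w \<bullet> F w) =
      (q ?u - ?A *v q ?v) \<bullet> F ?u + (q ?v - transpose ?A *v q ?u) \<bullet> F ?v"
      by (simp add: orbit_entry_def Let_def inv)
    also have "\<dots> = (q ?u - ?A *v q ?v) \<bullet> (F ?u - ?A *v F ?v)"
      by (simp add: inner_diff_left inner_diff_right inner_transpose_mult inner_orthogonal_mult[OF A]
          del: transpose_matrix_vector)
    finally show ?thesis .
  qed
  finally show ?thesis .
qed

lemma pinned_orbit_matrix_mult:
  fixes m :: "real^('v::finite set \<times> 'd::finite)"
  assumes e: "e \<in> arcs H"
    and m: "\<And>w k. w \<in> inner_orbits S \<theta> K \<Longrightarrow> m $ (w, k) = F w $ k"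
  shows "(pinned_orbit_matrix S \<theta> \<tau> K H q *v m) $ e =
    (\<Sum>w\<in>inner_orbits S \<theta> K. orbit_entry \<tau> H q e w \<bullet> F w)"
proof -
  let ?I = "inner_orbits S \<theta> K"
  have "(pinned_orbit_matrix S \<theta> \<tau> K H q *v m) $ e =
    (\<Sum>(w, k)\<in>UNIV \<times> UNIV. if w \<in> ?I then orbit_entry \<tau> H q e w $ k * m $ (w, k) else 0)"
    unfolding UNIV_Times_UNIV
    by (auto simp: matrix_vector_mult_def pinned_orbit_matrix_def e intro!: sum.cong)
  also have "\<dots> = (\<Sum>w\<in>UNIV. \<Sum>k\<in>UNIV. if w \<in> ?I then orbit_entry \<tau> H q e w $ k * m $ (w, k) else 0)"
    by (rule sum.cartesian_product[symmetric])
  also have "\<dots> = (\<Sum>w\<in>UNIV. if w \<in> ?I then orbit_entry \<tau> H q e w \<bullet> F w else 0)"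
    by (intro sum.cong) (auto simp: inner_vec_def m)
  also have "\<dots> = (\<Sum>w\<in>?I. orbit_entry \<tau> H q e w \<bullet> F w)"
    by (simp add: sum.If_cases)
  finally show ?thesis .
qed

context oriented_quotient
begin

section \<open>Symmetric velocity fields\<close>

lemma orthogonal_tau: "x \<in> carrier S \<Longrightarrow> orthogonal_matrix (\<tau> x)"
  and tau_mult: "x \<in> carrier S \<Longrightarrow> y \<in> carrier S \<Longrightarrow> \<tau> (x \<otimes>\<^bsub>S\<^esub> y) = \<tau> x ** \<tau> y"
  using tau_hom by (auto simp: hom_def orthogonal_group_def)

text \<open>An idempotent orthogonal matrix is the identity, because it can be cancelled by its
  transpose.\<close>

lemma tau_one: "\<tau> \<one>\<^bsub>S\<^esub> = mat 1"
proof -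
  have "\<tau> \<one>\<^bsub>S\<^esub> ** \<tau> \<one>\<^bsub>S\<^esub> = \<tau> \<one>\<^bsub>S\<^esub>" using tau_mult[of "\<one>\<^bsub>S\<^esub>" "\<one>\<^bsub>S\<^esub>"] by simp
  moreover have inv: "transpose (\<tau> \<one>\<^bsub>S\<^esub>) ** \<tau> \<one>\<^bsub>S\<^esub> = mat 1"
    using orthogonal_tau[of "\<one>\<^bsub>S\<^esub>"] by (simp add: orthogonal_matrix_def)
  ultimately show ?thesis by (metis matrix_mul_assoc matrix_mul_lid)
qed

text \<open>Common ground for \<open>G\<close> and its extended components. The pins are only
  required to lie in \<open>V\<close>, since the pins of an extended component may be inner vertices
  of \<open>G\<close> that have already been grounded.\<close>

definition invariant_subgraph :: "'v pinned_graph \<Rightarrow> bool" where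
  "invariant_subgraph K \<longleftrightarrow>
     inner K \<subseteq> V \<and> pinned K \<subseteq> V \<and> inner K \<inter> pinned K = {} \<and>
     (\<forall>x\<in>carrier S. \<theta> x ` inner K \<subseteq> inner K \<and> \<theta> x ` pinned K \<subseteq> pinned K)"

text \<open>
  A row of the matrix, applied to a symmetric velocity field \<open>f\<close> that vanishes on the pins, gives
  half the first-order change of the squared length of any edge in the orbit; this expression does not
  refer to the representatives, the directions and the gains chosen in the quotient.
\<close>

lemma row_mult_symmetric_field:
  fixes f p :: "'v \<Rightarrow> real^'d" and m :: "real^('v set \<times> 'd)"
  assumes K: "invariant_subgraph K" and H': "quotient_gain_graph S \<theta> K H'"
    and p: "symmetric_realisation S \<theta> \<tau> K p"
    and f: "symmetric_realisation S \<theta> \<tau> K f" "\<And>v. v \<in> pinned K \<Longrightarrow> f v = 0"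
    and e: "e \<in> arcs H'" "{a, b} \<in> e"
    and m: "\<And>w k. w \<in> inner_orbits S \<theta> K \<Longrightarrow> m $ (w, k) = f (rep H' w) $ k"
  shows "(pinned_orbit_matrix_at S \<theta> \<tau> K H' p *v m) $ e = (p a - p b) \<bullet> (f a - f b)"
proof -
  let ?u = "tail H' e" and ?v = "head H' e" and ?y = "gain H' e"
  let ?a = "rep H' ?u" and ?b = "rep H' ?v"
  have H'_props: "verts H' = inner_orbits S \<theta> K \<union> pinned_orbits S \<theta> K"
      "\<And>w. w \<in> verts H' \<Longrightarrow> rep H' w \<in> w" "?u \<in> verts H'" "?v \<in> verts H'" "?y \<in> carrier S"
      "e = {{\<theta> x ?a, \<theta> (x \<otimes>\<^bsub>S\<^esub> ?y) ?b} |x. x \<in> carrier S}"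
    using H' e(1) unfolding quotient_gain_graph_def by blast+
  have K_act: "v \<in> inner K \<Longrightarrow> \<theta> x v \<in> inner K" "v \<in> pinned K \<Longrightarrow> \<theta> x v \<in> pinned K"
    if "x \<in> carrier S" for x v
    using K that unfolding invariant_subgraph_def by blast+
  have orb: "w \<subseteq> inner K" if "w \<in> inner_orbits S \<theta> K" for w
    using that K_act by (auto simp: orbits_def orbit_def)
  have porb: "w \<subseteq> pinned K" if "w \<in> pinned_orbits S \<theta> K" for w
    using that K_act by (auto simp: orbits_def orbit_def)
  have rep_K: "rep H' w \<in> inner K \<union> pinned K" if "w \<in> verts H'" for w
    using H'_props(1) H'_props(2)[OF that] that orb porb by blast
  have f0: "f (rep H' w) = 0" if "w \<in> verts H'" "w \<notin> inner_orbits S \<theta> K" for w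
  proof -
    have "w \<in> pinned_orbits S \<theta> K" using that H'_props(1) by blast
    then show ?thesis using porb H'_props(2)[OF that(1)] f(2) by blast
  qed
  obtain x where x: "x \<in> carrier S" "{a, b} = {\<theta> x ?a, \<theta> (x \<otimes>\<^bsub>S\<^esub> ?y) ?b}"
    using subsetD[OF equalityD1[OF H'_props(6)] e(2)] by blast
  have sym_a: "g (\<theta> x ?a) = \<tau> x *v g ?a" and sym_b: "g (\<theta> (x \<otimes>\<^bsub>S\<^esub> ?y) ?b) = \<tau> x *v (\<tau> ?y *v g ?b)"
    if "symmetric_realisation S \<theta> \<tau> K g" for g :: "'v \<Rightarrow> real^'d"
  proof -
    show "g (\<theta> x ?a) = \<tau> x *v g ?a"
      using that x(1) rep_K[OF H'_props(3)] by (simp add: symmetric_realisation_def)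
    have "g (\<theta> (x \<otimes>\<^bsub>S\<^esub> ?y) ?b) = \<tau> (x \<otimes>\<^bsub>S\<^esub> ?y) *v g ?b"
      using that x(1) H'_props(5) rep_K[OF H'_props(4)] by (simp add: symmetric_realisation_def)
    then show "g (\<theta> (x \<otimes>\<^bsub>S\<^esub> ?y) ?b) = \<tau> x *v (\<tau> ?y *v g ?b)"
      using tau_mult[OF x(1) H'_props(5)] by (simp add: matrix_vector_mul_assoc)
  qed
  \<comment> \<open>The edge is unordered, so \<open>a\<close> and \<open>b\<close> match the two
    listed ends in one order or the other; swapping them changes the sign of both factors.\<close>
  have "(p a - p b) \<bullet> (f a - f b) =
    (p (\<theta> x ?a) - p (\<theta> (x \<otimes>\<^bsub>S\<^esub> ?y) ?b)) \<bullet> (f (\<theta> x ?a) - f (\<theta> (x \<otimes>\<^bsub>S\<^esub> ?y) ?b))"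
    using x(2) by (auto simp: doubleton_eq_iff inner_diff_left inner_diff_right)
  also have "\<dots> = (\<tau> x *v (p ?a - \<tau> ?y *v p ?b)) \<bullet> (\<tau> x *v (f ?a - \<tau> ?y *v f ?b))"
    by (simp add: sym_a[OF p] sym_b[OF p] sym_a[OF f(1)] sym_b[OF f(1)] matrix_vector_mult_diff_distrib)
  also have "\<dots> = (p ?a - \<tau> ?y *v p ?b) \<bullet> (f ?a - \<tau> ?y *v f ?b)"
    by (rule inner_orthogonal_mult[OF orthogonal_tau[OF x(1)]])
  also have "\<dots> = (\<Sum>w\<in>inner_orbits S \<theta> K. orbit_entry \<tau> H' (\<lambda>w. p (rep H' w)) e w \<bullet> f (rep H' w))"
    using f0 H'_props(3,4)
    by (intro sum_orbit_entry[where F = "\<lambda>w. f (rep H' w)", symmetric]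
        orthogonal_tau H'_props(5)) auto
  also have "\<dots> = (pinned_orbit_matrix_at S \<theta> \<tau> K H' p *v m) $ e"
    by (rule pinned_orbit_matrix_mult[OF e(1) m, symmetric])
  finally show ?thesis by simp
qed

text \<open>Because the action is free, exactly one group element carries the representative of an
  orbit to a given vertex of it. Arbitrary values at representatives can therefore be transported
  along the orbits without a compatibility condition from stabilisers.\<close>

lemma symmetric_extension:
  assumes C: "C \<subseteq> W \<union> Pins" and rep: "\<And>w. w \<in> C \<Longrightarrow> rp w \<in> w"
  obtains f :: "'v \<Rightarrow> real^'d" where "symmetric_realisation S \<theta> \<tau> G f"
    "\<And>v. v \<notin> \<Union>C \<Longrightarrow> f v = 0" "\<And>w. w \<in> C \<Longrightarrow> f (rp w) = X w"
proof -
  define g where "g v = (THE x. x \<in> carrier S \<and> v = \<theta> x (rp (orbit S \<theta> v)))" for v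
  define f where "f v = (if v \<in> \<Union>C then \<tau> (g v) *v X (orbit S \<theta> v) else 0)" for v
  have g: "g (\<theta> x (rp w)) = x" and orb: "orbit S \<theta> (\<theta> x (rp w)) = w"
    and C_mem: "\<theta> x (rp w) \<in> w" if "w \<in> C" "x \<in> carrier S" for w x
  proof -
    have w: "w = orbit S \<theta> (rp w)" "rp w \<in> V" using orbit_of_member[of w "rp w"] that C rep by auto
    show orb: "orbit S \<theta> (\<theta> x (rp w)) = w" using orbit_act[OF that(2) w(2)] w(1) by simp
    show "\<theta> x (rp w) \<in> w" using orb orbit_self[OF act_V[OF that(2) w(2)]] by simp
    \<comment> \<open>If \<open>x\<close> and \<open>y\<close> move the representative to the same
      vertex, then the product of the inverse of \<open>x\<close> with \<open>y\<close> stabilises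
      the representative, hence is the identity.\<close>
    have "y = x" if y: "y \<in> carrier S" "\<theta> x (rp w) = \<theta> y (rp w)" for y
    proof -
      have "\<theta> (inv\<^bsub>S\<^esub> x \<otimes>\<^bsub>S\<^esub> y) (rp w) = \<theta> (inv\<^bsub>S\<^esub> x) (\<theta> x (rp w))"
        using act.composition_rule[OF w(2)] y \<open>x \<in> carrier S\<close> by simp
      also have "\<dots> = \<theta> (inv\<^bsub>S\<^esub> x \<otimes>\<^bsub>S\<^esub> x) (rp w)"
        by (rule act.composition_rule[OF w(2), symmetric]) (simp_all add: \<open>x \<in> carrier S\<close>)
      also have "\<dots> = rp w" using act_one[OF w(2)] \<open>x \<in> carrier S\<close> by simp
      finally have "inv\<^bsub>S\<^esub> x \<otimes>\<^bsub>S\<^esub> y \<in> stabilizer S \<theta> (rp w)"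
        using y \<open>x \<in> carrier S\<close> by (simp add: stabilizer_def)
      then have "inv\<^bsub>S\<^esub> x \<otimes>\<^bsub>S\<^esub> y = \<one>\<^bsub>S\<^esub>"
        using free_action w(2) by (auto simp: free_on_vertices_def)
      then have "inv\<^bsub>S\<^esub> y = inv\<^bsub>S\<^esub> x"
        using y(1) \<open>x \<in> carrier S\<close> by (intro inv_equality) simp_all
      then have "inv\<^bsub>S\<^esub> (inv\<^bsub>S\<^esub> y) = inv\<^bsub>S\<^esub> (inv\<^bsub>S\<^esub> x)" by (rule arg_cong)
      then show ?thesis unfolding inv_inv[OF y(1)] inv_inv[OF \<open>x \<in> carrier S\<close>] .
    qed
    then show "g (\<theta> x (rp w)) = x"
      unfolding g_def orb by (intro the_equality) (simp_all only: that(2) simp_thms)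
  qed
  have f_eq: "f (\<theta> x (rp w)) = \<tau> x *v X w" if "w \<in> C" "x \<in> carrier S" for w x
    using g[OF that] orb[OF that] C_mem[OF that] that(1) by (auto simp: f_def)
  have mem: "\<exists>w x. w \<in> C \<and> x \<in> carrier S \<and> v = \<theta> x (rp w)" if vC: "v \<in> \<Union>C" for v
  proof -
    obtain w where w: "w \<in> C" "v \<in> w" using vC by blast
    then have "w = orbit S \<theta> (rp w)" using orbit_of_member[of w "rp w"] C rep by auto
    then obtain x where "x \<in> carrier S" "v = \<theta> x (rp w)"
      using w(2) unfolding orbit_def by blast
    then show ?thesis using w(1) by blast
  qed
  show ?thesis
  proof (rule that[of f])
    show "f v = 0" if "v \<notin> \<Union>C" for v using that by (simp add: f_def)
    show "f (rp w) = X w" if "w \<in> C" for w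
    proof -
      have "rp w \<in> V" using orbit_of_member[of w "rp w"] C rep that by auto
      then show ?thesis using f_eq[OF that, of "\<one>\<^bsub>S\<^esub>"] act_one tau_one by simp
    qed
    show "symmetric_realisation S \<theta> \<tau> G f"
      unfolding symmetric_realisation_def
    proof (intro ballI)
      fix x v assume x: "x \<in> carrier S" and v: "v \<in> V"
      show "\<tau> x *v f v = f (\<theta> x v)"
      proof (cases "v \<in> \<Union>C")
        case True
        then obtain w y where w: "w \<in> C" "y \<in> carrier S" "v = \<theta> y (rp w)" using mem by blast
        have "rp w \<in> V" using orbit_of_member[of w "rp w"] C rep w(1) by auto
        then have "\<theta> x v = \<theta> (x \<otimes>\<^bsub>S\<^esub> y) (rp w)"
          using act.composition_rule x w(2,3) by simp
        then show ?thesis using f_eq[OF w(1)] w(2,3) x tau_mult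
          by (simp add: matrix_vector_mul_assoc)
      next
        case False
        have "\<theta> x v \<notin> \<Union>C"
        proof
          assume "\<theta> x v \<in> \<Union>C"
          then obtain w where w: "w \<in> C" "\<theta> x v \<in> w" by blast
          then have "w = orbit S \<theta> v"
            using orbit_of_member[of w "\<theta> x v"] C orbit_act[OF x v] by auto
          then show False using False w(1) orbit_self[OF v] by blast
        qed
        then show ?thesis using False by (simp add: f_def)
      qed
    qed
  qed
qed

end

section \<open>Isostatic extended components\<close>

text \<open>For distinct ends the entry at the head is minus the transposed gain matrix applied to
  the entry at the tail. That matrix is invertible, so both entries vanish together.\<close>

lemma orbit_entry_0_transfer:
  fixes \<tau> :: "'g \<Rightarrow> real^'d^'d"
  assumes A: "orthogonal_matrix (\<tau> (gain H e))"
    and w: "w \<in> {tail H e, head H e}" "orbit_entry \<tau> H q e w = 0"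
  shows "orbit_entry \<tau> H q e w' = 0"
proof -
  let ?u = "tail H e" and ?v = "head H e" and ?A = "\<tau> (gain H e)"
  let ?a = "q ?u - ?A *v q ?v"
  have inv: "matrix_inv ?A = transpose ?A" by (rule matrix_inv_orthogonal[OF A])
  have A1: "?A ** transpose ?A = mat 1" "transpose ?A ** ?A = mat 1"
    using A by (auto simp: orthogonal_matrix_def)
  show ?thesis
  proof (cases "w' \<in> {?u, ?v}")
    case True
    show ?thesis
    proof (cases "?u = ?v")
      case True
      then show ?thesis using w \<open>w' \<in> {?u, ?v}\<close> by auto
    next
      case False
      have v: "orbit_entry \<tau> H q e ?v = - (transpose ?A *v ?a)"
        using False A1 by (simp add: orbit_entry_def Let_def inv matrix_vector_mult_diff_distrib
            matrix_vector_mul_assoc del: transpose_matrix_vector)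
      have u: "orbit_entry \<tau> H q e ?u = ?a"
        using False by (simp add: orbit_entry_def Let_def)
      have "?a = 0"
      proof (cases "w = ?u")
        case True
        then show ?thesis using w(2) u by simp
      next
        case False
        then have "transpose ?A *v ?a = 0" using w v by (simp del: transpose_matrix_vector)
        then have "?A *v (transpose ?A *v ?a) = 0" by (simp del: transpose_matrix_vector)
        then show ?thesis
          by (simp add: matrix_vector_mul_assoc A1 del: transpose_matrix_vector)
      qed
      then show ?thesis using u v True by (auto simp del: transpose_matrix_vector)
    qed
  qed (simp add: orbit_entry_eq_0)
qed

lemma pinned_orbit_matrix_column_eq_0:
  "c \<notin> inner_orbits S \<theta> K \<times> UNIV \<Longrightarrow> pinned_orbit_matrix S \<theta> \<tau> K H q $ e $ c = 0"
  by (auto simp: pinned_orbit_matrix_def mem_Times_iff)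

locale isostatic_quotient = oriented_quotient S \<theta> \<tau> G H D
  for S :: "('g, 'b) monoid_scheme" and \<theta> :: "'g \<Rightarrow> 'v::finite \<Rightarrow> 'v"
    and \<tau> :: "'g \<Rightarrow> real^'d^'d" and G H D +
  assumes isostatic: "pinned_isostatic S \<theta> \<tau> G"
begin

abbreviation M :: "('v \<Rightarrow> real^'d) \<Rightarrow> real^('v set \<times> 'd)^('v set set)" where
  "M p \<equiv> pinned_orbit_matrix_at S \<theta> \<tau> G H p"

text \<open>The ranks of all symmetric realisations are bounded by the number of rows, so a maximum
  is attained. This gives content to \<open>pinned_isostatic\<close>, which quantifies universally
  over regular realisations.\<close>

lemma regular_exists: "\<exists>p. pinned_regular S \<theta> \<tau> G H p"
proof -
  let ?sym = "symmetric_realisation S \<theta> \<tau> G"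
  have "?sym (\<lambda>_. 0)" by (simp add: symmetric_realisation_def)
  moreover have "rank (M q) < Suc (card (UNIV :: 'v set set set))" for q
    by (rule le_imp_less_Suc, rule rank_le_card_rows) simp
  ultimately obtain p where "?sym p" "\<forall>q. ?sym q \<longrightarrow> rank (M q) \<le> rank (M p)"
    using ex_has_greatest_nat[of ?sym "\<lambda>_. 0" "\<lambda>q. rank (M q)"] by blast
  then show ?thesis by (auto simp: pinned_regular_def)
qed

lemma card_columns: "card (X \<times> (UNIV :: 'd set)) = CARD('d) * card X"
  by (simp add: card_cartesian_product)

lemma rank_regular: "pinned_regular S \<theta> \<tau> G H p \<Longrightarrow> rank (M p) = CARD('d) * card W"
  using isostatic quotient_H by (simp add: pinned_isostatic_def)

lemma card_arcs: "card (arcs H) = CARD('d) * card W"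
  using isostatic arcs_H by (simp add: pinned_isostatic_def)

lemma regular_kernel:
  assumes "pinned_regular S \<theta> \<tau> G H p" "x \<in> coordinate_space (W \<times> UNIV)" "M p *v x = 0"
  shows "x = 0"
  using kernel_trivial_if_rank_eq_card[OF pinned_orbit_matrix_column_eq_0 _ assms(2,3)]
    rank_regular[OF assms(1)] card_columns by simp

lemma gain_H: "e \<in> arcs H \<Longrightarrow> gain H e \<in> carrier S"
  using quotient_H by (auto simp: quotient_gain_graph_def)

lemma row_support:
  assumes "e \<in> arcs H \<Longrightarrow> w \<noteq> tail D e \<and> w \<noteq> head D e"
  shows "M p $ e $ (w, k) = 0"
proof -
  have "w \<noteq> tail H e \<and> w \<noteq> head H e" if "e \<in> arcs H"
    using ends_D[OF that] assms[OF that] by metis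
  then show ?thesis by (simp add: pinned_orbit_matrix_def orbit_entry_eq_0)
qed

text \<open>An entry that vanishes at one end makes the whole row vanish. At a regular realisation
  the rank equals the number of arcs, so no row can be lost.\<close>

lemma regular_row_nonzero:
  assumes p: "pinned_regular S \<theta> \<tau> G H p" and e: "e \<in> arcs H"
    and w: "w \<in> W" "w = tail D e \<or> w = head D e"
  shows "\<exists>k. M p $ e $ (w, k) \<noteq> 0"
proof (rule ccontr)
  assume zero: "\<nexists>k. M p $ e $ (w, k) \<noteq> 0"
  let ?q = "\<lambda>w. p (rep H w)"
  have "orbit_entry \<tau> H ?q e w $ k = 0" for k
    using zero w(1) e by (simp add: pinned_orbit_matrix_def)
  then have "orbit_entry \<tau> H ?q e w = 0" by (simp add: vec_eq_iff)
  moreover have "w \<in> {tail H e, head H e}" using w(2) ends_D[OF e] by auto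
  ultimately have "orbit_entry \<tau> H ?q e w' = 0" for w'
    using orbit_entry_0_transfer[where \<tau> = \<tau> and H = H and e = e, OF orthogonal_tau[OF gain_H[OF e]]] by blast
  then have "M p $ f $ c = 0" if "f \<notin> arcs H - {e}" for f c
    using that by (auto simp: pinned_orbit_matrix_def)
  then have "rank (M p) \<le> card (arcs H - {e})" by (rule rank_le_card_rows)
  also have "\<dots> < card (arcs H)" using e by (intro card_Diff1_less) auto
  finally show False using rank_regular[OF p] card_arcs by simp
qed

section \<open>Invariance of extended components under the group\<close>

lemma invariant_G: "invariant_subgraph G"
  using inner_pinned_disjoint edge_subset act_inner act_pinned
  by (auto simp: invariant_subgraph_def)

lemma act_inj_orbits:
  assumes "C \<subseteq> W \<union> Pins" "x \<in> carrier S" "v \<in> V"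
  shows "\<theta> x v \<in> \<Union>C \<longleftrightarrow> v \<in> \<Union>C"
proof -
  have "orbit S \<theta> v \<in> W \<union> Pins" using assms(3) by (auto simp: orbits_def)
  moreover have "\<theta> x v \<in> orbit S \<theta> v" using assms(2) by (auto simp: orbit_def)
  ultimately show ?thesis
    using in_Union_orbits_iff[of "orbit S \<theta> v" v C] in_Union_orbits_iff[of "orbit S \<theta> v" "\<theta> x v" C]
      orbit_self[OF assms(3)] assms(1) by simp
qed

lemma edges_extended_act:
  assumes "C \<subseteq> W" "U \<subseteq> W" "x \<in> carrier S" "e \<in> edges (extended_component G U C)"
  shows "\<theta> x ` e \<in> edges (extended_component G U C)"
proof -
  have e: "e \<in> edges G" "e \<inter> \<Union>C \<noteq> {}" "e \<subseteq> \<Union>(C \<union> U \<union> Pins)"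
    using assms(4) by (auto simp: edges_extended)
  have eV: "v \<in> V" if "v \<in> e" for v using edge_subset[OF e(1)] that by blast
  have C1: "C \<subseteq> W \<union> Pins" and C2: "C \<union> U \<union> Pins \<subseteq> W \<union> Pins" using assms(1,2) by auto
  obtain v where "v \<in> e" "v \<in> \<Union>C" using e(2) by blast
  then have "\<theta> x v \<in> \<Union>C" using act_inj_orbits[OF C1 assms(3) eV] by simp
  then have "\<theta> x ` e \<inter> \<Union>C \<noteq> {}" using \<open>v \<in> e\<close> by blast
  moreover have "\<theta> x ` e \<subseteq> \<Union>(C \<union> U \<union> Pins)"
  proof (rule image_subsetI)
    fix v assume v: "v \<in> e"
    then have "v \<in> \<Union>(C \<union> U \<union> Pins)" using e(3) by (rule rev_subsetD)
    then show "\<theta> x v \<in> \<Union>(C \<union> U \<union> Pins)" using act_inj_orbits[OF C2 assms(3) eV[OF v]] by simp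
  qed
  ultimately show ?thesis using act_edges[OF assms(3) e(1)] unfolding edges_extended by simp
qed

lemma invariant_extended:
  assumes "C \<subseteq> W" "U \<subseteq> W"
  shows "invariant_subgraph (extended_component G U C)"
proof -
  let ?E = "extended_component G U C"
  have C1: "C \<subseteq> W \<union> Pins" using assms(1) by auto
  have inner_V: "\<Union>C \<subseteq> V" using inner_orbit_subset assms(1) by blast
  have edges_V: "\<Union>(edges ?E) \<subseteq> V" using edge_subset by (auto simp: edges_extended)
  have "\<theta> x v \<in> \<Union>C" if "x \<in> carrier S" "v \<in> \<Union>C" for x v
    using act_inj_orbits[OF C1 that(1)] inner_V that(2) by blast
  then have "\<theta> x ` \<Union>C \<subseteq> \<Union>C" if "x \<in> carrier S" for x
    using that by (intro image_subsetI) blast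
  moreover have "\<theta> x v \<in> \<Union>(edges ?E) - \<Union>C" if xv: "x \<in> carrier S" "v \<in> \<Union>(edges ?E) - \<Union>C" for x v
  proof -
    have "v \<in> V" using xv(2) edges_V by blast
    then have "\<theta> x v \<notin> \<Union>C" using act_inj_orbits[OF C1 xv(1)] xv(2) by simp
    moreover obtain e where "e \<in> edges ?E" "v \<in> e" using xv(2) by blast
    then have "\<theta> x v \<in> \<Union>(edges ?E)" using edges_extended_act[OF assms xv(1)] by blast
    ultimately show ?thesis by blast
  qed
  then have "\<theta> x ` (\<Union>(edges ?E) - \<Union>C) \<subseteq> \<Union>(edges ?E) - \<Union>C" if "x \<in> carrier S" for x
    using that by (intro image_subsetI) blast
  moreover have "\<Union>C \<inter> (\<Union>(edges ?E) - \<Union>C) = {}" "\<Union>(edges ?E) - \<Union>C \<subseteq> V"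
    using edges_V by blast+
  ultimately show ?thesis
    unfolding invariant_subgraph_def inner_extended pinned_extended using inner_V by simp
qed

lemma symmetric_subgraph:
  assumes "symmetric_realisation S \<theta> \<tau> G p" "invariant_subgraph K"
  shows "symmetric_realisation S \<theta> \<tau> K p"
proof -
  have "inner K \<union> pinned K \<subseteq> V" using assms(2) by (simp add: invariant_subgraph_def)
  then show ?thesis using assms(1) unfolding symmetric_realisation_def by blast
qed

text \<open>The matrix of \<open>G\<close> is block-triangular for \<open>U\<close>,
  \<open>C\<close> and the rest \<open>?R\<close>. A kernel vector for the component, continued by
  zero, is mapped into the rows of \<open>?R\<close>; the square block of \<open>?R\<close> can
  cancel that image, so injectivity of the whole matrix forces the vector to be supported on
  \<open>?R\<close>, that is, to vanish on \<open>C\<close>.\<close>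

lemma extended_kernel:
  assumes C: "C \<subseteq> W - U" "U \<subseteq> W" "arc_rel `` U \<subseteq> U" "arc_rel `` (U \<union> C) \<subseteq> U \<union> C"
    and p: "pinned_regular S \<theta> \<tau> G H p"
    and H': "quotient_gain_graph S \<theta> (extended_component G U C) H'"
    and x: "x \<in> coordinate_space (C \<times> UNIV)"
      "pinned_orbit_matrix_at S \<theta> \<tau> (extended_component G U C) H' p *v x = 0"
  shows "x = 0"
proof -
  let ?E = "extended_component G U C" and ?R = "W - (U \<union> C)"
  have CW: "C \<subseteq> W" and CWP: "C \<subseteq> W \<union> Pins" using C(1) by auto
  have verts_H': "C \<subseteq> verts H'" "arcs H' = out C" and rep_H': "\<And>w. w \<in> verts H' \<Longrightarrow> rep H' w \<in> w"
    using H' inner_orbits_extended[OF CW] edge_orbits_extended_eq_out[OF C]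
    by (auto simp: quotient_gain_graph_def)
  \<comment> \<open>\<open>f\<close> is the velocity field with coordinates \<open>x\<close> at the
    representatives of \<open>H'\<close>; it is zero off \<open>C\<close>, so it also vanishes on
    all pins of the component.\<close>
  obtain f :: "'v \<Rightarrow> real^'d" where f: "symmetric_realisation S \<theta> \<tau> G f"
      "\<And>v. v \<notin> \<Union>C \<Longrightarrow> f v = 0" "\<And>w. w \<in> C \<Longrightarrow> f (rep H' w) = (\<chi> k. x $ (w, k))"
    using symmetric_extension[OF CWP, of "rep H'" "\<lambda>w. \<chi> k. x $ (w, k)"] rep_H' verts_H'(1) by blast
  \<comment> \<open>The same field in the coordinates of \<open>H\<close>, whose representatives may
    differ from those of \<open>H'\<close>.\<close>
  define m :: "real^('v set \<times> 'd)"
    where "m = (\<chi> c. if fst c \<in> W then f (rep H (fst c)) $ snd c else 0)"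
  have sym_p: "symmetric_realisation S \<theta> \<tau> G p" using p by (simp add: pinned_regular_def)
  have f_pins: "f v = 0" if "v \<in> pinned G" for v
    using that inner_orbit_subset CW inner_pinned_disjoint by (intro f(2)) blast
  have row_G: "(M p *v m) $ e = (p a - p b) \<bullet> (f a - f b)" if "e \<in> arcs H" "{a, b} \<in> e" for e a b
    using f_pins that
    by (intro row_mult_symmetric_field[OF invariant_G quotient_H sym_p f(1)]) (auto simp: m_def)
  have row_E: "(p a - p b) \<bullet> (f a - f b) = 0" if "e \<in> out C" "{a, b} \<in> e" for e a b
  proof -
    have inv: "invariant_subgraph ?E" by (rule invariant_extended[OF CW C(2)])
    have "(pinned_orbit_matrix_at S \<theta> \<tau> ?E H' p *v x) $ e = (p a - p b) \<bullet> (f a - f b)"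
      using that verts_H'(2) f(2,3) inner_orbits_extended[OF CW]
      by (intro row_mult_symmetric_field[OF inv H' symmetric_subgraph[OF sym_p inv]
            symmetric_subgraph[OF f(1) inv]]) (auto simp: pinned_extended)
    then show ?thesis using x(2) by simp
  qed
  have closed: "head D e \<in> Y \<union> Pins" if "e \<in> arcs H" "tail D e \<in> Y" "arc_rel `` Y \<subseteq> Y" "Y \<subseteq> W" for e Y
    using arc_rel_closed_iff[OF that(4), of Y] that arcs_D by (auto simp: out_def)
  have mJ: "m \<in> coordinate_space (W \<times> UNIV)" by (auto simp: coordinate_space_def m_def)
  \<comment> \<open>Rows starting in \<open>C\<close> vanish because \<open>x\<close> is in the
    kernel for the component; rows starting in \<open>U\<close> have both ends outside
    \<open>C\<close>, where the field is zero.\<close>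
  have mQ: "M p *v m \<in> coordinate_space (out ?R)"
    unfolding coordinate_space_def
  proof (intro CollectI allI impI)
    fix e assume e: "e \<notin> out ?R"
    show "(M p *v m) $ e = 0"
    proof (cases "e \<in> arcs H")
      case True
      obtain e' where "e' \<in> e" using True arcs_H edge_orbit_self by (fastforce simp: orbits_def)
      then obtain a b where ab: "{a, b} \<in> e" "a \<in> tail H e" "b \<in> head H e"
        using edge_cases[OF True] by metis
      have "(p a - p b) \<bullet> (f a - f b) = 0"
      proof (cases "tail D e \<in> C")
        case True
        then show ?thesis using row_E ab(1) \<open>e \<in> arcs H\<close> arcs_D by (simp add: out_def)
      next
        case False
        then have "tail D e \<in> U" using e True tail_D[OF True] arcs_D by (auto simp: out_def)
        then have "head D e \<in> U \<union> Pins" using closed[OF True _ C(3,2)] by blast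
        then have "tail H e \<notin> C" "head H e \<notin> C"
          using ends_D[OF True] False C(1) orbits_disjoint \<open>tail D e \<in> U\<close> by auto
        then have "a \<notin> \<Union>C" "b \<notin> \<Union>C"
          using in_Union_orbits_iff[OF _ ab(2) CWP] in_Union_orbits_iff[OF _ ab(3) CWP]
            tail_H[OF True] head_H[OF True] verts_H by auto
        then show ?thesis using f(2) by simp
      qed
      then show ?thesis using row_G[OF True ab(1)] by simp
    qed (simp add: matrix_vector_mult_def pinned_orbit_matrix_def)
  qed
  \<comment> \<open>Closedness of \<open>U \<union> C\<close> means that rows starting there have no
    entry in the columns of \<open>?R\<close>.\<close>
  have im: "M p *v y \<in> coordinate_space (out ?R)" if y: "y \<in> coordinate_space (?R \<times> UNIV)" for y
    unfolding coordinate_space_def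
  proof (intro CollectI allI impI)
    fix e assume e: "e \<notin> out ?R"
    have "M p $ e $ c * y $ c = 0" for c
    proof (cases "fst c \<in> ?R")
      case True
      have "M p $ e $ (fst c, snd c) = 0"
      proof (rule row_support)
        assume a: "e \<in> arcs H"
        then have "tail D e \<in> U \<union> C" using e tail_D[OF a] arcs_D by (auto simp: out_def)
        moreover have "head D e \<in> U \<union> C \<union> Pins"
          using closed[OF a calculation C(4)] CW C(2) by blast
        ultimately show "fst c \<noteq> tail D e \<and> fst c \<noteq> head D e"
          using True orbits_disjoint by auto
      qed
      then show ?thesis by simp
    next
      case False
      then have "c \<notin> ?R \<times> UNIV" by (simp add: mem_Times_iff)
      then have "y $ c = 0" using y unfolding coordinate_space_def by blast
      then show ?thesis by simp
    qed
    then show "(M p *v y) $ e = 0"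
      unfolding matrix_vector_mult_def vec_lambda_beta by (intro sum.neutral ballI)
  qed
  have mT: "m \<in> coordinate_space (?R \<times> UNIV)"
  proof (rule in_coordinate_space_if_image[OF regular_kernel[OF p] _ _ im mJ mQ])
    show "card (?R \<times> (UNIV :: 'd set)) = card (out ?R)" using card_columns card_out[of ?R] by simp
  qed auto
  have m0: "f (rep H w) = 0" if "w \<in> C" for w
  proof -
    have "m $ (w, k) = 0" for k
      using that mT by (simp add: coordinate_space_def)
    then show ?thesis using that CW by (auto simp: m_def vec_eq_iff)
  qed
  \<comment> \<open>The two representatives of an orbit differ by a group element, so by symmetry a
    field that vanishes at one vanishes at the other.\<close>
  have "x $ (w, k) = 0" if "w \<in> C" for w k
  proof -
    have w: "rep H w \<in> w" "rep H' w \<in> w" "w \<in> W \<union> Pins"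
      using that rep_in rep_H' verts_H verts_H'(1) CW by auto
    have "rep H' w \<in> orbit S \<theta> (rep H w)" using orbit_of_member(1)[OF w(3,1)] w(2) by simp
    then obtain g where "g \<in> carrier S" "rep H' w = \<theta> g (rep H w)" by (auto simp: orbit_def)
    then have "f (rep H' w) = \<tau> g *v f (rep H w)"
      using f(1) orbit_of_member(2)[OF w(3,1)] by (auto simp: symmetric_realisation_def)
    then show ?thesis using f(3)[OF that] m0[OF that] by (simp add: vec_eq_iff)
  qed
  moreover have "x $ c = 0" if "fst c \<notin> C" for c
    using x(1) that by (cases c) (simp add: coordinate_space_def)
  ultimately show "x = 0" by (metis prod.collapse vec_eq_iff zero_index)
qed

text \<open>The count comes from the out-degrees. The rank is at most the number of genuine columns,
  and triviality of the kernel at one realisation gives the matching lower bound.\<close>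

lemma closed_imp_groundable:
  assumes C: "C \<noteq> {}" "C \<subseteq> W - U" "U \<subseteq> W" "arc_rel `` U \<subseteq> U" "arc_rel `` (U \<union> C) \<subseteq> U \<union> C"
  shows "groundable S \<theta> \<tau> G U C"
proof -
  let ?E = "extended_component G U C"
  have CW: "C \<subseteq> W" using C(2) by auto
  have orbits_E: "inner_orbits S \<theta> ?E = C" by (rule inner_orbits_extended[OF CW])
  have "card (edge_orbits S \<theta> ?E) = CARD('d) * card C"
    using edge_orbits_extended_eq_out[OF C(2-5)] card_out[OF CW] by simp
  moreover have "rank (pinned_orbit_matrix_at S \<theta> \<tau> ?E H' q) = CARD('d) * card C"
    if H': "quotient_gain_graph S \<theta> ?E H'" and q: "pinned_regular S \<theta> \<tau> ?E H' q" for H' q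
  proof (rule antisym)
    show "rank (pinned_orbit_matrix_at S \<theta> \<tau> ?E H' q) \<le> CARD('d) * card C"
      unfolding card_columns[symmetric]
      by (rule rank_le_card_columns, rule pinned_orbit_matrix_column_eq_0) (simp add: orbits_E)
    obtain p where p: "pinned_regular S \<theta> \<tau> G H p" using regular_exists by blast
    \<comment> \<open>The realisation \<open>p\<close>, regular for \<open>G\<close>, need not be
      known to be regular for the component; it competes with \<open>q\<close>, whose rank is
      maximal.\<close>
    have "CARD('d) * card C \<le> rank (pinned_orbit_matrix_at S \<theta> \<tau> ?E H' p)"
      unfolding card_columns[symmetric]
      by (rule card_le_rank_if_kernel_trivial) (rule extended_kernel[OF C(2-5) p H'])
    also have "symmetric_realisation S \<theta> \<tau> ?E p"
      using p invariant_extended[OF CW C(3)] symmetric_subgraph by (auto simp: pinned_regular_def)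
    then have "rank (pinned_orbit_matrix_at S \<theta> \<tau> ?E H' p) \<le> rank (pinned_orbit_matrix_at S \<theta> \<tau> ?E H' q)"
      using q by (simp add: pinned_regular_def)
    finally show "CARD('d) * card C \<le> rank (pinned_orbit_matrix_at S \<theta> \<tau> ?E H' q)" .
  qed
  ultimately show ?thesis using C(1,2) by (simp add: groundable_def pinned_isostatic_def orbits_E)
qed

end

section \<open>The three decompositions\<close>

lemma take_Suc_Union: "i < length Cs \<Longrightarrow> \<Union>(set (take (Suc i) Cs)) = \<Union>(set (take i Cs)) \<union> Cs ! i"
  by (simp add: take_Suc_conv_app_nth Un_commute)

text \<open>A part closed inside the newest block can be grounded before the rest of that block;
  this is how minimality excludes such parts.\<close>

lemma Image_Un_closed:
  "r `` (U \<union> C) \<subseteq> U \<union> C \<Longrightarrow> r `` U \<subseteq> U \<Longrightarrow> X \<subseteq> C \<Longrightarrow> r `` X \<inter> C \<subseteq> X \<Longrightarrow> r `` (U \<union> X) \<subseteq> U \<union> X"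
  by blast

context isostatic_quotient
begin

subsection \<open>Strongly connected components\<close>

definition to_pins :: "'v set set" where
  "to_pins = {tail D e |e. e \<in> arcs D \<and> head D e \<in> Pins}"

abbreviation Z :: "('v set option, 'v set set) pre_digraph" where "Z \<equiv> identify_pins W D"

lemma arc_rel_subset: "arc_rel \<subseteq> W \<times> W"
  using tail_D arcs_D by (auto simp: arc_rel_def)

lemma to_pins_subset: "to_pins \<subseteq> W"
  using tail_D arcs_D by (auto simp: to_pins_def)

lemma arcs_ends_Z:
  "(Some a, Some b) \<in> arcs_ends Z \<longleftrightarrow> (a, b) \<in> arc_rel"
  "(Some a, None) \<in> arcs_ends Z \<longleftrightarrow> a \<in> to_pins"
  "(None, y) \<notin> arcs_ends Z"
proof -
  have ends: "arcs_ends Z =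
      (\<lambda>e. (Some (tail D e), if head D e \<in> W then Some (head D e) else None)) ` arcs D"
    using tail_D arcs_D
    by (auto simp: arcs_ends_def arc_to_ends_def identify_pins_def Let_def intro!: image_cong)
  show "(Some a, Some b) \<in> arcs_ends Z \<longleftrightarrow> (a, b) \<in> arc_rel"
    unfolding ends arc_rel_def by (auto split: if_splits)
  show "(Some a, None) \<in> arcs_ends Z \<longleftrightarrow> a \<in> to_pins"
  proof -
    have "head D e \<notin> W \<longleftrightarrow> head D e \<in> Pins" if "e \<in> arcs D" for e
      using head_D[of e] that arcs_D orbits_disjoint by auto
    then show ?thesis unfolding ends to_pins_def by (auto split: if_splits)
  qed
  show "(None, y) \<notin> arcs_ends Z" unfolding ends by auto
qed

lemma verts_Z: "verts Z = insert None (Some ` W)"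
  by (simp add: identify_pins_def Let_def)

text \<open>One induction serves both kinds of target: the sink emits no arc, so a path passes
  through inner orbits until its last step.\<close>

lemma reachable_from_Some:
  assumes "x \<rightarrow>\<^sup>*\<^bsub>Z\<^esub> y" "x = Some a"
  shows "case y of Some b \<Rightarrow> a \<in> W \<and> b \<in> W \<and> (a, b) \<in> arc_rel\<^sup>* |
    None \<Rightarrow> \<exists>b\<in>to_pins. (a, b) \<in> arc_rel\<^sup>*"
  using assms(1) unfolding reachable_def
proof (induction rule: rtrancl_on_induct)
  case base
  then show ?case using assms(2) by (auto simp: verts_Z)
next
  case (step y z)
  obtain b where b: "y = Some b" using step(2) arcs_ends_Z(3) by (cases y) auto
  then have ab: "a \<in> W" "(a, b) \<in> arc_rel\<^sup>*" using step by auto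
  show ?case
  proof (cases z)
    case None
    then show ?thesis using step(2) b ab arcs_ends_Z(2) by auto
  next
    case (Some c)
    then have "(b, c) \<in> arc_rel" using step(2) b arcs_ends_Z(1) by simp
    then show ?thesis using Some ab arc_rel_subset by (auto intro: rtrancl_into_rtrancl)
  qed
qed

lemma arc_rel_reachable:
  assumes "(a, b) \<in> arc_rel\<^sup>*" "a \<in> W"
  shows "Some a \<rightarrow>\<^sup>*\<^bsub>Z\<^esub> Some b"
  using assms(1)
proof induction
  case base
  then show ?case using assms(2) by (simp add: reachable_def verts_Z)
next
  case (step y z)
  then have "(Some y, Some z) \<in> arcs_ends Z" "Some z \<in> verts Z"
    using arcs_ends_Z(1) arc_rel_subset verts_Z by auto
  then show ?case using step(3) unfolding reachable_def by (rule rtrancl_on_into_rtrancl_on[rotated])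
qed

lemma reachable_Some_iff:
  "Some a \<rightarrow>\<^sup>*\<^bsub>Z\<^esub> Some b \<longleftrightarrow> a \<in> W \<and> b \<in> W \<and> (a, b) \<in> arc_rel\<^sup>*"
  using reachable_from_Some[of "Some a" "Some b" a] arc_rel_reachable[of a b] by auto

lemma reachable_None_iff:
  assumes "a \<in> W"
  shows "Some a \<rightarrow>\<^sup>*\<^bsub>Z\<^esub> None \<longleftrightarrow> (\<exists>b\<in>to_pins \<inter> W. (a, b) \<in> arc_rel\<^sup>*)"
proof
  assume "Some a \<rightarrow>\<^sup>*\<^bsub>Z\<^esub> None"
  then show "\<exists>b\<in>to_pins \<inter> W. (a, b) \<in> arc_rel\<^sup>*"
    using reachable_from_Some[of "Some a" None a] to_pins_subset by auto
next
  assume "\<exists>b\<in>to_pins \<inter> W. (a, b) \<in> arc_rel\<^sup>*"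
  then obtain b where b: "b \<in> to_pins" "(a, b) \<in> arc_rel\<^sup>*" by blast
  have "(Some a, Some b) \<in> rtrancl_on (verts Z) (arcs_ends Z)"
    using arc_rel_reachable[OF b(2) assms] by (simp add: reachable_def)
  moreover have "(Some b, None) \<in> arcs_ends Z" using arcs_ends_Z(2) b(1) by simp
  moreover have "None \<in> verts Z" by (simp add: verts_Z)
  ultimately show "Some a \<rightarrow>\<^sup>*\<^bsub>Z\<^esub> None"
    unfolding reachable_def by (rule rtrancl_on_into_rtrancl_on)
qed

lemma None_not_reachable_Some: "\<not> None \<rightarrow>\<^sup>*\<^bsub>Z\<^esub> Some a"
proof
  assume "None \<rightarrow>\<^sup>*\<^bsub>Z\<^esub> Some a"
  then have "Some a = None" unfolding reachable_def
    by (induction rule: rtrancl_on_induct) (use arcs_ends_Z(3) in auto)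
  then show False by simp
qed

text \<open>The sink reaches no inner orbit, so as a competitor for mutual reachability it never
  enlarges a component.\<close>

lemma scc_components:
  "{C. C \<subseteq> W \<and> Some ` C \<in> pre_digraph.sccs_verts Z} =
   {C. C \<subseteq> W \<and> C \<noteq> {} \<and> (\<forall>a\<in>C. \<forall>b\<in>C. (a, b) \<in> arc_rel\<^sup>*) \<and>
     (\<forall>a\<in>C. \<forall>b\<in>W - C. (a, b) \<notin> arc_rel\<^sup>* \<or> (b, a) \<notin> arc_rel\<^sup>*)}"
proof (intro Collect_cong conj_cong refl)
  fix C assume C: "C \<subseteq> W"
  have "(\<forall>u\<in>Some ` C. \<forall>v\<in>Some ` C. u \<rightarrow>\<^sup>*\<^bsub>Z\<^esub> v) \<longleftrightarrow> (\<forall>a\<in>C. \<forall>b\<in>C. (a, b) \<in> arc_rel\<^sup>*)"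
    using C by (simp add: reachable_Some_iff subset_iff)
  moreover have "(\<forall>u\<in>Some ` C. \<forall>v. v \<notin> Some ` C \<longrightarrow> \<not> u \<rightarrow>\<^sup>*\<^bsub>Z\<^esub> v \<or> \<not> v \<rightarrow>\<^sup>*\<^bsub>Z\<^esub> u) \<longleftrightarrow>
      (\<forall>a\<in>C. \<forall>b\<in>W - C. (a, b) \<notin> arc_rel\<^sup>* \<or> (b, a) \<notin> arc_rel\<^sup>*)"
    using C by (simp add: split_option_all None_not_reachable_Some reachable_Some_iff image_iff subset_iff)
      blast
  ultimately show "Some ` C \<in> pre_digraph.sccs_verts Z \<longleftrightarrow>
      C \<noteq> {} \<and> (\<forall>a\<in>C. \<forall>b\<in>C. (a, b) \<in> arc_rel\<^sup>*) \<and>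
      (\<forall>a\<in>C. \<forall>b\<in>W - C. (a, b) \<notin> arc_rel\<^sup>* \<or> (b, a) \<notin> arc_rel\<^sup>*)"
    by (simp add: pre_digraph.sccs_verts_def)
qed

text \<open>The common normal form: the other two orders are also transitive closures of one-step
  relations, and only those one-step relations remain to be compared.\<close>

lemma scc_decomposition_eq_chain:
  assumes "connected_chain arc_rel W As"
  shows "scc_decomposition W D = (set As,
    ({(Some A, Some B) |A B. A \<in> set As \<and> B \<in> set As \<and> A \<noteq> B \<and> (\<exists>a\<in>A. \<exists>b\<in>B. (a, b) \<in> arc_rel)} \<union>
     {(Some A, None) |A. A \<in> set As \<and> A \<inter> to_pins \<noteq> {}})\<^sup>+)"
proof -
  have AW: "A \<subseteq> W" if "A \<in> set As" for A using chain_Union[OF assms] that by blast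
  have "(\<exists>a\<in>A. \<exists>b\<in>B. Some a \<rightarrow>\<^sup>*\<^bsub>Z\<^esub> Some b) \<longleftrightarrow> (\<exists>a\<in>A. \<exists>b\<in>B. (a, b) \<in> arc_rel\<^sup>*)"
    if "A \<in> set As" "B \<in> set As" for A B
    using AW[OF that(1)] AW[OF that(2)] unfolding reachable_Some_iff by blast
  moreover have "(\<exists>a\<in>A. Some a \<rightarrow>\<^sup>*\<^bsub>Z\<^esub> None) \<longleftrightarrow> (\<exists>a\<in>A. \<exists>b\<in>to_pins \<inter> W. (a, b) \<in> arc_rel\<^sup>*)"
    if "A \<in> set As" for A
    using AW[OF that] reachable_None_iff by (intro bex_cong) auto
  ultimately show ?thesis
    unfolding scc_decomposition_def Let_def scc_components chain_sccs[OF assms, symmetric]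
      chain_trancl[OF assms]
    by (simp cong: conj_cong)
qed

subsection \<open>Runs of the Assur decomposition\<close>

lemma run_prefix_closed:
  assumes run: "\<And>i. i < length Cs \<Longrightarrow> groundable S \<theta> \<tau> G (\<Union>(set (take i Cs))) (Cs ! i)"
    and "i \<le> length Cs"
  shows "\<Union>(set (take i Cs)) \<subseteq> W \<and> arc_rel `` \<Union>(set (take i Cs)) \<subseteq> \<Union>(set (take i Cs))"
  using assms(2)
proof (induction i)
  case (Suc i)
  then have i: "i < length Cs" and IH: "\<Union>(set (take i Cs)) \<subseteq> W"
      "arc_rel `` \<Union>(set (take i Cs)) \<subseteq> \<Union>(set (take i Cs))" by auto
  have "Cs ! i \<subseteq> W" using run[OF i] by (auto simp: groundable_def)
  then show ?case using groundable_imp_closed[OF run[OF i] IH] IH(1) take_Suc_Union[OF i] by simp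
qed simp

text \<open>Minimality excludes closed proper parts of a component, and termination excludes
  leftovers.\<close>

lemma run_chain:
  assumes run: "Assur_run S \<theta> \<tau> G Cs"
  shows "connected_chain arc_rel W Cs"
proof -
  have gr: "groundable S \<theta> \<tau> G (\<Union>(set (take i Cs))) (Cs ! i)"
    and min: "\<And>C. C \<subset> Cs ! i \<Longrightarrow> \<not> groundable S \<theta> \<tau> G (\<Union>(set (take i Cs))) C"
    if "i < length Cs" for i
    using run that by (auto simp: Assur_run_def)
  have pre: "\<Union>(set (take i Cs)) \<subseteq> W" "arc_rel `` \<Union>(set (take i Cs)) \<subseteq> \<Union>(set (take i Cs))"
    if "i \<le> length Cs" for i
    using run_prefix_closed[of Cs i] gr that by auto
  have all: "\<Union>(set Cs) = W"
  proof (rule ccontr)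
    assume "\<Union>(set Cs) \<noteq> W"
    moreover have sub: "\<Union>(set Cs) \<subseteq> W" "arc_rel `` \<Union>(set Cs) \<subseteq> \<Union>(set Cs)"
      using pre[of "length Cs"] by simp_all
    moreover have "\<Union>(set Cs) \<union> (W - \<Union>(set Cs)) = W" using sub(1) by blast
    moreover have "arc_rel `` W \<subseteq> W" using arc_rel_subset by blast
    \<comment> \<open>All remaining orbits together are groundable because \<open>W\<close> itself
      is closed, so a finished run has nothing left.\<close>
    ultimately have "groundable S \<theta> \<tau> G (\<Union>(set Cs)) (W - \<Union>(set Cs))"
      by (intro closed_imp_groundable) auto
    then show False using run by (simp add: Assur_run_def)
  qed
  have "Cs ! i \<noteq> {} \<and> (\<forall>j<i. Cs ! i \<inter> Cs ! j = {}) \<and>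
        arc_rel `` (Cs ! i) \<subseteq> \<Union>(set (take (Suc i) Cs)) \<and>
        (\<forall>X. X \<noteq> {} \<longrightarrow> X \<subset> Cs ! i \<longrightarrow> \<not> arc_rel `` X \<inter> Cs ! i \<subseteq> X)" if i: "i < length Cs" for i
  proof (intro conjI allI impI)
    let ?U = "\<Union>(set (take i Cs))"
    have Ci: "Cs ! i \<subseteq> W - ?U" "Cs ! i \<noteq> {}" using gr[OF i] by (auto simp: groundable_def)
    show "Cs ! i \<noteq> {}" by fact
    show "Cs ! i \<inter> Cs ! j = {}" if "j < i" for j
    proof -
      have "Cs ! j \<in> set (take i Cs)" using that i by (auto simp: in_set_conv_nth)
      then show ?thesis using Ci by blast
    qed
    have Suc_i: "arc_rel `` (?U \<union> Cs ! i) \<subseteq> ?U \<union> Cs ! i"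
      using pre(2)[of "Suc i"] i take_Suc_Union[OF i] by simp
    then show "arc_rel `` (Cs ! i) \<subseteq> \<Union>(set (take (Suc i) Cs))"
      using take_Suc_Union[OF i] by auto
    show "\<not> arc_rel `` X \<inter> Cs ! i \<subseteq> X" if X: "X \<noteq> {}" "X \<subset> Cs ! i" for X
    proof
      assume "arc_rel `` X \<inter> Cs ! i \<subseteq> X"
      then have "arc_rel `` (?U \<union> X) \<subseteq> ?U \<union> X"
        using Image_Un_closed[OF Suc_i pre(2)[of i]] i X(2) by simp
      then have "groundable S \<theta> \<tau> G ?U X"
        using pre[of i] i X Ci by (intro closed_imp_groundable) auto
      then show False using min[OF i X(2)] by simp
    qed
  qed
  then show ?thesis using all by (simp add: connected_chain_def)
qed

lemma run_exists: "\<exists>Cs. Assur_run S \<theta> \<tau> G Cs"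
proof -
  let ?step = "\<lambda>U C. groundable S \<theta> \<tau> G U C \<and> (\<forall>C'. C' \<subset> C \<longrightarrow> \<not> groundable S \<theta> \<tau> G U C')"
  let ?part = "\<lambda>Cs. \<forall>i<length Cs. ?step (\<Union>(set (take i Cs))) (Cs ! i)"
  have "\<exists>Ds. Assur_run S \<theta> \<tau> G Ds" if "?part Cs" for Cs
    using that
  proof (induction "card (W - \<Union>(set Cs))" arbitrary: Cs rule: less_induct)
    case less
    show ?case
    proof (cases "\<exists>C. groundable S \<theta> \<tau> G (\<Union>(set Cs)) C")
      case True
      \<comment> \<open>Least cardinality implies minimality under inclusion. Grounding
        \<open>C\<close> shrinks the remainder on which the induction runs.\<close>
      then obtain C where C: "groundable S \<theta> \<tau> G (\<Union>(set Cs)) C"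
          "\<And>C'. groundable S \<theta> \<tau> G (\<Union>(set Cs)) C' \<Longrightarrow> card C \<le> card C'"
        using ex_has_least_nat[of "groundable S \<theta> \<tau> G (\<Union>(set Cs))" _ card] by blast
      have "\<not> groundable S \<theta> \<tau> G (\<Union>(set Cs)) C'" if "C' \<subset> C" for C'
        using C(2)[of C'] psubset_card_mono[OF _ that] by fastforce
      then have "?step (\<Union>(set Cs)) C" using C(1) by blast
      then have "?part (Cs @ [C])" using less(2) by (simp add: nth_append less_Suc_eq)
      moreover have "W - \<Union>(set (Cs @ [C])) \<subset> W - \<Union>(set Cs)"
        using C(1) by (auto simp: groundable_def)
      then have "card (W - \<Union>(set (Cs @ [C]))) < card (W - \<Union>(set Cs))"
        by (intro psubset_card_mono) auto
      ultimately show ?thesis using less(1) by blast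
    next
      case False
      then show ?thesis using less(2) unfolding Assur_run_def by blast
    qed
  qed
  from this[of "[]"] show ?thesis by simp
qed

text \<open>\<open>joins\<close> ignores directions, but between two components the direction is
  forced: arcs lead from the later component to the earlier one, and between an inner orbit and a
  pin they lead to the pin.\<close>

lemma run_decomposition:
  assumes run: "Assur_run S \<theta> \<tau> G Cs"
  shows "Assur_decomposition S \<theta> G H Cs = scc_decomposition W D"
proof -
  have ch: "connected_chain arc_rel W Cs" by (rule run_chain[OF run])
  have CW: "C \<subseteq> W" if "C \<in> set Cs" for C using chain_Union[OF ch] that by blast
  have joins: "(\<exists>e\<in>arcs H. joins H e A B) \<longleftrightarrow>
    (\<exists>e\<in>arcs H. tail D e \<in> A \<and> head D e \<in> B \<or> tail D e \<in> B \<and> head D e \<in> A)" for A B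
  proof (intro bex_cong refl)
    fix e assume "e \<in> arcs H"
    from ends_D[OF this]
    show "joins H e A B \<longleftrightarrow> tail D e \<in> A \<and> head D e \<in> B \<or> tail D e \<in> B \<and> head D e \<in> A"
      unfolding joins_def by auto
  qed
  have arc: "(\<exists>e\<in>arcs H. tail D e \<in> A \<and> head D e \<in> B) \<longleftrightarrow> (\<exists>a\<in>A. \<exists>b\<in>B. (a, b) \<in> arc_rel)"
    if "B \<subseteq> W" for A B
    using that arcs_D by (fastforce simp: arc_rel_def)
  have no_arc: "\<not> (\<exists>e\<in>arcs H. tail D e \<in> Cs ! j \<and> head D e \<in> Cs ! i)"
    if ij: "j < i" "i < length Cs" for i j
  proof
    assume "\<exists>e\<in>arcs H. tail D e \<in> Cs ! j \<and> head D e \<in> Cs ! i"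
    then obtain a b where ab: "a \<in> Cs ! j" "b \<in> Cs ! i" "(a, b) \<in> arc_rel"
      using arc[of "Cs ! i" "Cs ! j"] CW nth_mem[OF ij(2)] by blast
    obtain k where k: "k \<le> j" "k < length Cs" "b \<in> Cs ! k"
      using chain_rtrancl_index_le[OF ch r_into_rtrancl[OF ab(3)] _ ab(1)] ij by auto
    then show False using chain_index_unique[OF ch k(2) ij(2) k(3) ab(2)] ij(1) by simp
  qed
  have blocks: "{(Some (Cs ! i), Some (Cs ! j)) |i j.
        j < i \<and> i < length Cs \<and> (\<exists>e\<in>arcs H. joins H e (Cs ! i) (Cs ! j))} =
    {(Some A, Some B) |A B. A \<in> set Cs \<and> B \<in> set Cs \<and> A \<noteq> B \<and> (\<exists>a\<in>A. \<exists>b\<in>B. (a, b) \<in> arc_rel)}"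
    (is "?L = ?R")
  proof (intro equalityI subsetI)
    fix x assume "x \<in> ?L"
    then obtain i j where ij: "x = (Some (Cs ! i), Some (Cs ! j))" "j < i" "i < length Cs"
        "\<exists>e\<in>arcs H. joins H e (Cs ! i) (Cs ! j)" by blast
    then have j: "j < length Cs" by simp
    have "\<exists>e\<in>arcs H. tail D e \<in> Cs ! i \<and> head D e \<in> Cs ! j"
      using ij(4) no_arc[OF ij(2,3)] unfolding joins by blast
    then have ab: "\<exists>a\<in>Cs ! i. \<exists>b\<in>Cs ! j. (a, b) \<in> arc_rel"
      using arc[OF CW[OF nth_mem[OF j]]] by simp
    have "Cs ! i \<inter> Cs ! j = {}" "Cs ! i \<noteq> {}" using ch ij(2,3) by (auto simp: connected_chain_def)
    then have "Cs ! i \<noteq> Cs ! j" by auto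
    then show "x \<in> ?R" using ij(1) nth_mem[OF ij(3)] nth_mem[OF j] ab by simp
  next
    fix x assume "x \<in> ?R"
    then obtain A B a b where AB: "x = (Some A, Some B)" "A \<in> set Cs" "B \<in> set Cs" "A \<noteq> B"
        "a \<in> A" "b \<in> B" "(a, b) \<in> arc_rel" by blast
    obtain i where i: "i < length Cs" "A = Cs ! i" using AB(2) by (metis in_set_conv_nth)
    obtain j where j: "j < length Cs" "B = Cs ! j" using AB(3) by (metis in_set_conv_nth)
    have ex: "\<exists>e\<in>arcs H. tail D e \<in> A \<and> head D e \<in> B" using arc[OF CW[OF AB(3)]] AB(5-7) by blast
    then have "\<not> i < j" using no_arc[of i j] i j by blast
    moreover have "i \<noteq> j" using AB(4) i j by auto
    ultimately have "j < i" by simp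
    moreover have "\<exists>e\<in>arcs H. joins H e (Cs ! i) (Cs ! j)" using ex i(2) j(2) unfolding joins by blast
    ultimately show "x \<in> ?L" using AB(1) i j by blast
  qed
  have "(\<exists>e\<in>arcs H. joins H e A Pins) \<longleftrightarrow> A \<inter> to_pins \<noteq> {}" for A
    unfolding joins using tail_D orbits_disjoint arcs_D by (fastforce simp: to_pins_def)
  then have ground: "{(Some A, None) |A. A \<in> set Cs \<and> (\<exists>e\<in>arcs H. joins H e A Pins)} =
      {(Some A, None) |A. A \<in> set Cs \<and> A \<inter> to_pins \<noteq> {}}" by simp
  show ?thesis
    unfolding Assur_decomposition_def directly_above_def scc_decomposition_eq_chain[OF ch]
      blocks ground ..
qed

text \<open>Let \<open>B\<close> be the inner orbits of an isostatic sub-pinned graph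
  \<open>K\<close>. Counting shows that the edge orbits of \<open>K\<close> are exactly
  \<open>out B\<close>, so \<open>U \<union> B\<close> is closed and \<open>B\<close> is groundable
  after \<open>U\<close>. Minimality gives \<open>B = C\<close>, and the edges and pins then agree
  as well.\<close>

lemma minimal_groundable_Assur:
  assumes U: "U \<subseteq> W" "arc_rel `` U \<subseteq> U" and gr: "groundable S \<theta> \<tau> G U C"
    and min: "\<And>C'. C' \<subset> C \<Longrightarrow> \<not> groundable S \<theta> \<tau> G U C'"
  shows "Assur S \<theta> \<tau> (extended_component G U C)"
proof -
  let ?E = "extended_component G U C"
  have C: "C \<subseteq> W - U" and iso: "pinned_isostatic S \<theta> \<tau> ?E" using gr by (auto simp: groundable_def)
  then have CW: "C \<subseteq> W" by blast
  have closed: "arc_rel `` (U \<union> C) \<subseteq> U \<union> C" by (rule groundable_imp_closed[OF gr U])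
  have orbits_E: "edge_orbits S \<theta> ?E = out C" by (rule edge_orbits_extended_eq_out[OF C U closed])
  have "K = ?E" if K: "sub_pinned_graph S \<theta> K ?E" "pinned_isostatic S \<theta> \<tau> K" for K
  proof -
    have sub: "inner K \<noteq> {}" "inner K \<subseteq> \<Union>C" "pinned K \<subseteq> \<Union>(edges ?E) - \<Union>C" "edges K \<subseteq> edges ?E"
      and edges_K: "\<And>e. e \<in> edges K \<Longrightarrow> e \<subseteq> inner K \<union> pinned K"
      and act_K: "\<And>x v. x \<in> carrier S \<Longrightarrow> v \<in> inner K \<Longrightarrow> \<theta> x v \<in> inner K"
        "\<And>x e. x \<in> carrier S \<Longrightarrow> e \<in> edges K \<Longrightarrow> \<theta> x ` e \<in> edges K"
      using K(1)
      by (simp_all add: sub_pinned_graph_def inner_extended pinned_extended image_subset_iff)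
    define B where "B = inner_orbits S \<theta> K"
    have inner_V: "inner K \<subseteq> V" using sub(2) CW inner_orbit_subset by blast
    have orb: "orbit S \<theta> v \<in> B" if "v \<in> inner K" for v using that by (auto simp: B_def orbits_def)
    have orb_C: "orbit S \<theta> v = w" if "v \<in> w" "w \<in> C" for v w
      using orbit_of_member(1)[of w v] that CW by blast
    have BC: "B \<subseteq> C"
    proof
      fix w assume "w \<in> B"
      then obtain v where v: "v \<in> inner K" "w = orbit S \<theta> v" by (auto simp: B_def orbits_def)
      then obtain w' where "w' \<in> C" "v \<in> w'" using sub(2) by blast
      then show "w \<in> C" using orb_C v(2) by simp
    qed
    have Union_B: "\<Union>B = inner K"
    proof (intro equalityI subsetI)
      fix v assume "v \<in> \<Union>B"
      then show "v \<in> inner K" using act_K(1) by (auto simp: B_def orbits_def orbit_def)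
    next
      fix v assume "v \<in> inner K"
      then show "v \<in> \<Union>B" using orb[of v] orbit_self[of v] inner_V by blast
    qed
    have edges_G: "edges K \<subseteq> edges G" using sub(4) by (auto simp: edges_extended)
    have Union_edges: "\<Union>(edge_orbits S \<theta> K) = edges K"
      by (rule edges_eq_Union[OF edges_G act_K(2)])
    have orbits_K: "edge_orbits S \<theta> K \<subseteq> out C"
      unfolding orbits_E[symmetric] using sub(4) by (auto simp: orbits_def)
    \<comment> \<open>The pins of \<open>K\<close> avoid \<open>C\<close>, so an end of an edge of
      \<open>K\<close> that lies in an orbit of \<open>C\<close> must be an inner vertex of
      \<open>K\<close>.\<close>
    have end_B: "w \<in> B" if w: "e \<in> edges K" "e \<in> \<epsilon>" "\<epsilon> \<in> arcs H" "w = tail D \<epsilon> \<or> w = head D \<epsilon>" "w \<in> C"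
      for e \<epsilon> w
    proof -
      have "e \<inter> \<Union>{w} \<noteq> {}" using edge_subset_iff(2)[OF w(3,2), of "{w}"] w(4,5) CW by blast
      then obtain v where v: "v \<in> e" "v \<in> w" by blast
      then have "v \<in> inner K" using edges_K[OF w(1)] sub(3) w(5) by blast
      then show ?thesis using orb orb_C[OF v(2) w(5)] by metis
    qed
    have mem: "\<exists>e\<in>edges K. e \<in> \<epsilon>" if eps: "\<epsilon> \<in> edge_orbits S \<theta> K" for \<epsilon>
    proof -
      obtain e where e: "e \<in> edges K" "\<epsilon> = edge_orbit e" using eps by (auto simp: orbits_def)
      then show ?thesis using edge_orbit_self[of e] edges_G by auto
    qed
    have "edge_orbits S \<theta> K \<subseteq> out B"
    proof
      fix \<epsilon> assume eps: "\<epsilon> \<in> edge_orbits S \<theta> K"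
      then have "\<epsilon> \<in> arcs H" "tail D \<epsilon> \<in> C" using orbits_K arcs_D by (auto simp: out_def)
      then show "\<epsilon> \<in> out B" using mem[OF eps] end_B[of _ \<epsilon> "tail D \<epsilon>"] arcs_D by (auto simp: out_def)
    qed
    then have eq_out: "edge_orbits S \<theta> K = out B"
      using K(2) BC CW by (intro eq_out_if_card) (auto simp: pinned_isostatic_def B_def)
    have heads: "head D \<epsilon> \<in> U \<union> B \<union> Pins" if eps: "\<epsilon> \<in> out B" for \<epsilon>
    proof -
      have "\<epsilon> \<in> out (U \<union> C)" using eps BC by (auto simp: out_def)
      then have "head D \<epsilon> \<in> U \<union> C \<union> Pins"
        using arc_rel_closed_iff[of "U \<union> C"] closed CW U(1) by blast
      moreover have "head D \<epsilon> \<in> B" if "head D \<epsilon> \<in> C"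
        using mem[of \<epsilon>] end_B[of _ \<epsilon> "head D \<epsilon>"] eps eq_out arcs_D that by (auto simp: out_def)
      ultimately show ?thesis by blast
    qed
    have "B = C"
    proof (rule ccontr)
      assume "B \<noteq> C"
      then have "B \<subset> C" using BC by blast
      have "arc_rel `` B \<subseteq> U \<union> B" using arc_rel_closed_iff[of "U \<union> B" B] heads BC CW U(1) by auto
      then have "arc_rel `` (U \<union> B) \<subseteq> U \<union> B" using U(2) by blast
      moreover have "B \<noteq> {}" using sub(1) Union_B by auto
      ultimately have "groundable S \<theta> \<tau> G U B"
        using BC C U by (intro closed_imp_groundable) auto
      then show False using min[OF \<open>B \<subset> C\<close>] by simp
    qed
    then have inner_eq: "inner K = inner ?E" using Union_B by (simp add: inner_extended)
    have "\<Union>(edge_orbits S \<theta> ?E) = edges ?E"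
      using edges_extended_act[OF CW U(1)]
      by (intro edges_eq_Union) (auto simp: edges_extended)
    then have edges_eq: "edges K = edges ?E"
      using Union_edges eq_out orbits_E \<open>B = C\<close> by simp
    have "\<Union>(edges ?E) \<subseteq> \<Union>C \<union> pinned K"
      using edges_K edges_eq inner_eq unfolding inner_extended by blast
    \<comment> \<open>Every pin of the extended component lies on one of its edges, so the pins are
      recovered from the edges.\<close>
    then have "pinned K = pinned ?E" using sub(3) unfolding pinned_extended by blast
    then show ?thesis using inner_eq edges_eq by (intro pinned_graph.equality) auto
  qed
  then show ?thesis using iso unfolding Assur_def by blast
qed

lemma run_Assur:
  assumes run: "Assur_run S \<theta> \<tau> G Cs" and i: "i < length Cs"
  shows "Assur S \<theta> \<tau> (extended_component G (\<Union>(set (take i Cs))) (Cs ! i))"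
proof -
  have gr: "groundable S \<theta> \<tau> G (\<Union>(set (take j Cs))) (Cs ! j)" if "j < length Cs" for j
    using run that by (auto simp: Assur_run_def)
  have U: "\<Union>(set (take i Cs)) \<subseteq> W" "arc_rel `` \<Union>(set (take i Cs)) \<subseteq> \<Union>(set (take i Cs))"
    using run_prefix_closed[of Cs i] gr i by auto
  show ?thesis
    by (rule minimal_groundable_Assur[OF U gr[OF i]]) (use run i in \<open>simp add: Assur_run_def\<close>)
qed

end

lemma block_lower_triangularD:
  fixes A :: "real^('w::finite \<times> 'd::finite)^'e"
  assumes "block_lower_triangular A R Y bs"
  shows "\<Union>(fst ` set bs) = R" and "\<Union>(snd ` set bs) = Y"
    and "i < length bs \<Longrightarrow> j < length bs \<Longrightarrow> i \<noteq> j \<Longrightarrow> fst (bs ! i) \<inter> fst (bs ! j) = {}"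
    and "i < length bs \<Longrightarrow> j < length bs \<Longrightarrow> i \<noteq> j \<Longrightarrow> snd (bs ! i) \<inter> snd (bs ! j) = {}"
    and "(R', Y') \<in> set bs \<Longrightarrow> Y' \<noteq> {}"
    and "(R', Y') \<in> set bs \<Longrightarrow> card R' = CARD('d) * card Y'"
    and "i < j \<Longrightarrow> j < length bs \<Longrightarrow> e \<in> fst (bs ! i) \<Longrightarrow> w \<in> snd (bs ! j) \<Longrightarrow> A $ e $ (w, k) = 0"
  using assms unfolding block_lower_triangular_def by (simp_all add: Ball_def split_paired_all)

context isostatic_quotient
begin

subsection \<open>Block-triangular decompositions\<close>

text \<open>Stated for an arbitrary \<open>X\<close> because it is applied both to the whole matrix
  and to a supposed splitting of a single diagonal block.\<close>

lemma blocks_out: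
  assumes p: "pinned_regular S \<theta> \<tau> G H p" and X: "X \<subseteq> W"
    and bs: "block_lower_triangular (M p) (out X) X bs"
  shows "i < length bs \<Longrightarrow> fst (bs ! i) = out (snd (bs ! i))"
    and "i < length bs \<Longrightarrow> arc_rel `` snd (bs ! i) \<inter> X \<subseteq> \<Union>(set (take (Suc i) (map snd bs)))"
proof -
  note rows = block_lower_triangularD(1)[OF bs] and cols = block_lower_triangularD(2)[OF bs]
    and disj = block_lower_triangularD(3)[OF bs] and square = block_lower_triangularD(6)[OF bs]
    and zero = block_lower_triangularD(7)[OF bs]
  \<comment> \<open>Entries to the right of the diagonal vanish while both inner ends of a row carry
    nonzero entries, so the ends cannot lie in later blocks.\<close>
  have index: "\<exists>j\<le>i. w \<in> snd (bs ! j)"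
    if w: "i < length bs" "e \<in> fst (bs ! i)" "w \<in> X" "w = tail D e \<or> w = head D e" for i e w
  proof -
    have "e \<in> arcs H" using rows w(1,2) nth_mem arcs_D by (fastforce simp: out_def)
    then obtain k where k: "M p $ e $ (w, k) \<noteq> 0" using regular_row_nonzero[OF p, of e w] w(3,4) X by blast
    obtain b where "b \<in> set bs" "w \<in> snd b" using cols w(3) by blast
    then obtain j where j: "j < length bs" "w \<in> snd (bs ! j)" by (metis in_set_conv_nth)
    then have "\<not> i < j" using zero[OF _ j(1) w(2) j(2)] k by blast
    then show ?thesis using j by (meson not_le)
  qed
  have out_eq: "i < length bs \<Longrightarrow> fst (bs ! i) = out (snd (bs ! i))" for i
  \<comment> \<open>The tail of a row of block \<open>i\<close> lies in some block
    \<open>j \<le> i\<close>. If \<open>j < i\<close>, the induction hypothesis would already place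
    the row in block \<open>j\<close>, against disjointness. So the rows lie in
    \<open>out (snd (bs ! i))\<close>, and squareness makes them all of it.\<close>
  proof (induction i rule: less_induct)
    case (less i)
    have "fst (bs ! i) \<subseteq> out (snd (bs ! i))"
    proof
      fix e assume e: "e \<in> fst (bs ! i)"
      then have "e \<in> out X" using rows nth_mem[OF less(2)] by blast
      then have eX: "e \<in> arcs D" "tail D e \<in> X" by (auto simp: out_def)
      then obtain j where j: "j \<le> i" "tail D e \<in> snd (bs ! j)" using index[OF less(2) e] by blast
      have "j = i"
      proof (rule ccontr)
        assume "j \<noteq> i"
        then have "e \<in> fst (bs ! j)" using less(1)[of j] less(2) j eX(1) by (simp add: out_def)
        then show False using disj[of i j] \<open>j \<noteq> i\<close> e j(1) less(2) by fastforce
      qed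
      then show "e \<in> out (snd (bs ! i))" using j eX by (simp add: out_def)
    qed
    moreover have "snd (bs ! i) \<subseteq> W" using cols X nth_mem[OF less(2)] by blast
    moreover have "card (fst (bs ! i)) = CARD('d) * card (snd (bs ! i))"
      using square[of "fst (bs ! i)" "snd (bs ! i)"] nth_mem[OF less(2)] by simp
    ultimately show ?case by (intro eq_out_if_card)
  qed
  then show "i < length bs \<Longrightarrow> fst (bs ! i) = out (snd (bs ! i))" .
  assume i: "i < length bs"
  show "arc_rel `` snd (bs ! i) \<inter> X \<subseteq> \<Union>(set (take (Suc i) (map snd bs)))"
  proof
    fix b assume "b \<in> arc_rel `` snd (bs ! i) \<inter> X"
    then obtain e where e: "e \<in> arcs D" "tail D e \<in> snd (bs ! i)" "b = head D e" "b \<in> X"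
      by (auto simp: arc_rel_def)
    then have "e \<in> fst (bs ! i)" using out_eq[OF i] by (simp add: out_def)
    then obtain j where "j \<le> i" "b \<in> snd (bs ! j)" using index[OF i _ e(4)] e(3) by blast
    then show "b \<in> \<Union>(set (take (Suc i) (map snd bs)))"
      using i by (subst in_Union_take_iff) (auto intro!: exI[of _ j])
  qed
qed

text \<open>A part \<open>X\<close> closed inside a block \<open>A\<close> would split it: the rows
  starting in \<open>X\<close> avoid the columns of \<open>A - X\<close>, and both pieces are square
  because every inner orbit has out-degree \<open>CARD('d)\<close>.\<close>

lemma maximal_blocks_chain:
  assumes p: "pinned_regular S \<theta> \<tau> G H p"
    and bs: "maximal_block_lower_triangular (M p) (edge_orbits S \<theta> G) W bs"
  shows "connected_chain arc_rel W (map snd bs)" and "(R, A) \<in> set bs \<Longrightarrow> R = out A"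
proof -
  have blt: "block_lower_triangular (M p) (out W) W bs"
    and max: "\<And>R A cs. (R, A) \<in> set bs \<Longrightarrow> block_lower_triangular (M p) R A cs \<Longrightarrow> \<not> length cs \<ge> 2"
    using bs arcs_H out_W unfolding maximal_block_lower_triangular_def by auto
  note bo = blocks_out[OF p subset_refl blt]
  show R: "R = out A" if "(R, A) \<in> set bs" for R A
    using bo(1) that by (metis in_set_conv_nth fst_conv snd_conv)
  note cols = block_lower_triangularD(2)[OF blt] and disj = block_lower_triangularD(4)[OF blt]
    and ne = block_lower_triangularD(5)[OF blt]
  show "connected_chain arc_rel W (map snd bs)"
    unfolding connected_chain_def
  proof (intro conjI allI impI)
    show "\<Union>(set (map snd bs)) = W" using cols by simp
    fix i assume "i < length (map snd bs)"
    then have i: "i < length bs" by simp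
    let ?A = "map snd bs ! i"
    have A: "?A = snd (bs ! i)" using i by simp
    have mem: "(out ?A, ?A) \<in> set bs" using bo(1)[OF i] nth_mem[OF i] A by (metis prod.collapse)
    show "?A \<noteq> {}" using ne[OF mem] .
    show "?A \<inter> map snd bs ! j = {}" if "j < i" for j using disj[of i j] i that by simp
    show "arc_rel `` ?A \<subseteq> \<Union>(set (take (Suc i) (map snd bs)))"
      using bo(2)[OF i] A arc_rel_subset by auto
    fix X assume X: "X \<noteq> {}" "X \<subset> ?A"
    show "\<not> arc_rel `` X \<inter> ?A \<subseteq> X"
    proof
      assume closed: "arc_rel `` X \<inter> ?A \<subseteq> X"
      have AW: "?A \<subseteq> W" using cols mem by force
      have zero: "M p $ e $ (w, k) = 0" if "e \<in> out X" "w \<in> ?A - X" for e w k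
      proof (rule row_support)
        have "head D e \<in> X" if "head D e \<in> ?A"
          using closed that \<open>e \<in> out X\<close> AW by (auto simp: arc_rel_def out_def)
        then show "w \<noteq> tail D e \<and> w \<noteq> head D e" using that by (auto simp: out_def)
      qed
      have card: "card (out X) = CARD('d) * card X" "card (out (?A - X)) = CARD('d) * card (?A - X)"
        using X AW by (auto intro!: card_out)
      have "block_lower_triangular (M p) (out ?A) ?A [(out X, X), (out (?A - X), ?A - X)]"
        unfolding block_lower_triangular_def
      proof (intro conjI)
        show "\<Union>(fst ` set [(out X, X), (out (?A - X), ?A - X)]) = out ?A"
          using X by (auto simp: out_def)
        show "\<Union>(snd ` set [(out X, X), (out (?A - X), ?A - X)]) = ?A" using X by auto
        show "\<forall>(R', W')\<in>set [(out X, X), (out (?A - X), ?A - X)].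
            W' \<noteq> {} \<and> card R' = CARD('d) * card W'"
          using X card by auto
      qed (use zero in \<open>auto simp: less_Suc_eq nth_Cons out_def split: nat.splits\<close>)
      then show False using max[OF mem] by fastforce
    qed
  qed
qed

text \<open>Arcs never lead to later blocks of a chain, so giving each block its outgoing rows
  yields the triangular form; a finer splitting would contradict connectedness of a block.\<close>

lemma maximal_blocks_exist:
  assumes p: "pinned_regular S \<theta> \<tau> G H p" and ch: "connected_chain arc_rel W As"
  shows "maximal_block_lower_triangular (M p) (edge_orbits S \<theta> G) W (map (\<lambda>A. (out A, A)) As)"
proof -
  let ?bs = "map (\<lambda>A. (out A, A)) As"
  have AW: "A \<subseteq> W" if "A \<in> set As" for A using chain_Union[OF ch] that by blast
  have ne: "A \<noteq> {}" if "A \<in> set As" for A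
    using ch that unfolding connected_chain_def by (metis in_set_conv_nth)
  have disj: "As ! i \<inter> As ! j = {}" if "i < length As" "j < length As" "i \<noteq> j" for i j
    using chain_index_unique[OF ch that(1,2)] that(3) by blast
  have "block_lower_triangular (M p) (out W) W ?bs"
    unfolding block_lower_triangular_def
  proof (intro conjI allI impI ballI)
    show "\<Union>(fst ` set ?bs) = out W" using chain_Union[OF ch] by (auto simp: out_def)
    show "\<Union>(snd ` set ?bs) = W" using chain_Union[OF ch] by (simp add: image_image)
    show "snd (?bs ! i) \<inter> snd (?bs ! j) = {}" if "i < length ?bs" "j < length ?bs" "i \<noteq> j" for i j
      using disj that by simp
    show "fst (?bs ! i) \<inter> fst (?bs ! j) = {}" if "i < length ?bs" "j < length ?bs" "i \<noteq> j" for i j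
      using disj[of i j] that by (auto simp: out_def)
    show "case b of (R', W') \<Rightarrow> W' \<noteq> {} \<and> card R' = CARD('d) * card W'" if "b \<in> set ?bs" for b
      using that ne card_out AW by auto
    fix i j e w k assume ij: "i < j" "j < length ?bs" and e: "e \<in> fst (?bs ! i)" and w: "w \<in> snd (?bs ! j)"
    then have j: "j < length As" and i: "i < length As" by auto
    show "M p $ e $ (w, k) = 0"
    proof (rule row_support)
      have t: "e \<in> arcs D" "tail D e \<in> As ! i" and w': "w \<in> As ! j" using e w i j by (auto simp: out_def)
      have "w \<noteq> head D e"
      proof
        assume "w = head D e"
        then have "(tail D e, w) \<in> arc_rel" using t(1) w' AW[OF nth_mem[OF j]] by (auto simp: arc_rel_def)
        then obtain l where l: "l \<le> i" "l < length As" "w \<in> As ! l"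
          using chain_rtrancl_index_le[OF ch r_into_rtrancl i t(2)] by blast
        then show False using chain_index_unique[OF ch l(2) j l(3) w'] ij(1) by simp
      qed
      then show "w \<noteq> tail D e \<and> w \<noteq> head D e" using chain_index_unique[OF ch i j t(2)] w' ij(1) by auto
    qed
  qed
  moreover have "\<not> length cs \<ge> 2" if A: "A \<in> set As" and cs: "block_lower_triangular (M p) (out A) A cs"
    for A cs
  proof
    assume len: "length cs \<ge> 2"
    have l: "0 < length cs" "1 < length cs" using len by linarith+
    let ?X = "snd (cs ! 0)"
    note cols = block_lower_triangularD(2)[OF cs] and disj = block_lower_triangularD(4)[OF cs l zero_neq_one]
      and ne = block_lower_triangularD(5)[OF cs]
    have ne': "?X \<noteq> {}" "snd (cs ! 1) \<noteq> {}"
      using ne nth_mem[OF l(1)] nth_mem[OF l(2)] by (metis prod.collapse)+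
    have sub: "?X \<subseteq> A" "snd (cs ! 1) \<subseteq> A" using cols nth_mem[OF l(1)] nth_mem[OF l(2)] by blast+
    then have "?X \<subset> A" using disj ne' by blast
    \<comment> \<open>The first block of a splitting has nothing before it, so it is closed inside
      \<open>A\<close>.\<close>
    moreover have "arc_rel `` ?X \<inter> A \<subseteq> ?X"
      using blocks_out(2)[OF p AW[OF A] cs l(1)] l(1) by (cases cs) auto
    moreover have "\<not> arc_rel `` X \<inter> A \<subseteq> X" if "X \<noteq> {}" "X \<subset> A" for X
    proof -
      obtain i where "i < length As" "A = As ! i" using A by (metis in_set_conv_nth)
      then show ?thesis using ch that by (simp add: connected_chain_def)
    qed
    ultimately show False using ne'(1) by blast
  qed
  ultimately show ?thesis
    unfolding maximal_block_lower_triangular_def using arcs_H out_W by auto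
qed

text \<open>The reference direction of \<open>H\<close> may disagree with \<open>D\<close>, but one
  end of the row is its tail in \<open>A\<close>, so the end that meets \<open>Y\<close> is the head
  in \<open>D\<close>.\<close>

lemma out_touches_iff:
  assumes "A \<inter> Y = {}"
  shows "(\<exists>e\<in>out A. tail H e \<in> Y \<or> head H e \<in> Y) \<longleftrightarrow> (\<exists>e\<in>out A. head D e \<in> Y)"
proof (intro bex_cong refl)
  fix e assume "e \<in> out A"
  then have "e \<in> arcs H" "tail D e \<notin> Y" using assms arcs_D by (auto simp: out_def)
  then show "tail H e \<in> Y \<or> head H e \<in> Y \<longleftrightarrow> head D e \<in> Y" using ends_D[of e] by auto
qed

lemma blocks_decomposition:
  assumes p: "pinned_regular S \<theta> \<tau> G H p"
    and bs: "maximal_block_lower_triangular (M p) (edge_orbits S \<theta> G) W bs"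
  shows "block_decomposition S \<theta> G H bs = scc_decomposition W D"
proof -
  let ?As = "map snd bs"
  have ch: "connected_chain arc_rel W ?As" and R: "\<And>R A. (R, A) \<in> set bs \<Longrightarrow> R = out A"
    using maximal_blocks_chain[OF p bs] by blast+
  have arcs_blocks: "(\<exists>e\<in>out A. tail H e \<in> B \<or> head H e \<in> B) \<longleftrightarrow> (\<exists>a\<in>A. \<exists>b\<in>B. (a, b) \<in> arc_rel)"
    if AB: "A \<in> set ?As" "B \<in> set ?As" "A \<noteq> B" for A B
  proof -
    have "A \<inter> B = {}" using chain_blocks_disjoint[OF ch AB(1,2)] AB(3) by blast
    then have "(\<exists>e\<in>out A. tail H e \<in> B \<or> head H e \<in> B) \<longleftrightarrow> (\<exists>e\<in>out A. head D e \<in> B)"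
      by (rule out_touches_iff)
    moreover have "B \<subseteq> W" using chain_Union[OF ch] AB(2) by blast
    then have "(\<exists>e\<in>out A. head D e \<in> B) \<longleftrightarrow> (\<exists>a\<in>A. \<exists>b\<in>B. (a, b) \<in> arc_rel)"
      unfolding out_def arc_rel_def by blast
    ultimately show ?thesis by simp
  qed
  have arcs_pins: "(\<exists>e\<in>out A. tail H e \<in> Pins \<or> head H e \<in> Pins) \<longleftrightarrow> A \<inter> to_pins \<noteq> {}"
    if A: "A \<in> set ?As" for A
  proof -
    have "A \<inter> Pins = {}" using chain_Union[OF ch] A orbits_disjoint by blast
    then show ?thesis using out_touches_iff[of A Pins] by (auto simp: out_def to_pins_def)
  qed
  have blocks: "{(Some A, Some B) |R A R' B. (R, A) \<in> set bs \<and> (R', B) \<in> set bs \<and> A \<noteq> B \<and>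
        (\<exists>e\<in>R. tail H e \<in> B \<or> head H e \<in> B)} =
      {(Some A, Some B) |A B. A \<in> set ?As \<and> B \<in> set ?As \<and> A \<noteq> B \<and> (\<exists>a\<in>A. \<exists>b\<in>B. (a, b) \<in> arc_rel)}"
    (is "?L = ?R")
  proof (intro equalityI subsetI)
    fix x assume "x \<in> ?L"
    then obtain R' A R'' B where *: "x = (Some A, Some B)" "(R', A) \<in> set bs" "(R'', B) \<in> set bs"
      "A \<noteq> B" "\<exists>e\<in>R'. tail H e \<in> B \<or> head H e \<in> B" by blast
    then have "A \<in> set ?As" "B \<in> set ?As" by force+
    then show "x \<in> ?R" using arcs_blocks[of A B] * R[OF *(2)] by simp
  next
    fix x assume "x \<in> ?R"
    then obtain A B where *: "x = (Some A, Some B)" "A \<in> set ?As" "B \<in> set ?As"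
      "A \<noteq> B" "\<exists>a\<in>A. \<exists>b\<in>B. (a, b) \<in> arc_rel" by blast
    then have "(out A, A) \<in> set bs" "(out B, B) \<in> set bs" using R by force+
    then show "x \<in> ?L" using arcs_blocks[of A B] * by blast
  qed
  have ground: "{(Some A, None) |R A. (R, A) \<in> set bs \<and>
        (\<exists>e\<in>R. tail H e \<in> Pins \<or> head H e \<in> Pins)} =
      {(Some A, None) |A. A \<in> set ?As \<and> A \<inter> to_pins \<noteq> {}}" (is "?L = ?R")
  proof (intro equalityI subsetI)
    fix x assume "x \<in> ?L"
    then obtain R' A where *: "x = (Some A, None)" "(R', A) \<in> set bs"
      "\<exists>e\<in>R'. tail H e \<in> Pins \<or> head H e \<in> Pins" by blast
    then have "A \<in> set ?As" by force
    then show "x \<in> ?R" using arcs_pins[of A] * R[OF *(2)] by simp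
  next
    fix x assume "x \<in> ?R"
    then obtain A where *: "x = (Some A, None)" "A \<in> set ?As" "A \<inter> to_pins \<noteq> {}" by blast
    then have "(out A, A) \<in> set bs" using R by force
    then show "x \<in> ?L" using arcs_pins[of A] * by blast
  qed
  show ?thesis
    unfolding block_decomposition_def block_arcs_def scc_decomposition_eq_chain[OF ch]
      blocks ground by simp
qed

end

theorem theorem6:
  fixes S :: "('g, 'b) monoid_scheme"
    and \<theta> :: "'g \<Rightarrow> 'v::finite \<Rightarrow> 'v"
    and \<tau> :: "'g \<Rightarrow> real^'d^'d"
    and G :: "'v pinned_graph"
    and H :: "('v, 'g) gain_graph"
    and D :: "('v set, 'v set set) pre_digraph"
  assumes "group S" and "finite (carrier S)"
    and "pinned_graph G"
    and "acts_on_pinned_graph S \<theta> G"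
    and "free_on_vertices S \<theta> G"
    and "\<tau> \<in> hom S orthogonal_group"
    and "pinned_isostatic S \<theta> \<tau> G"
    and "quotient_gain_graph S \<theta> G H"
    and "directed_orientation CARD('d) S \<theta> G H D"
  shows "(\<exists>Cs. Assur_run S \<theta> \<tau> G Cs) \<and>
    (\<forall>Cs. Assur_run S \<theta> \<tau> G Cs \<longrightarrow>
       Assur_decomposition S \<theta> G H Cs = scc_decomposition (inner_orbits S \<theta> G) D \<and>
       (\<forall>i<length Cs. Assur S \<theta> \<tau> (extended_component G (\<Union>(set (take i Cs))) (Cs ! i)))) \<and>
    (\<forall>p. pinned_regular S \<theta> \<tau> G H p \<longrightarrow>
       (\<exists>bs. maximal_block_lower_triangular (pinned_orbit_matrix_at S \<theta> \<tau> G H p)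
          (edge_orbits S \<theta> G) (inner_orbits S \<theta> G) bs) \<and>
       (\<forall>bs. maximal_block_lower_triangular (pinned_orbit_matrix_at S \<theta> \<tau> G H p)
          (edge_orbits S \<theta> G) (inner_orbits S \<theta> G) bs \<longrightarrow>
          block_decomposition S \<theta> G H bs = scc_decomposition (inner_orbits S \<theta> G) D))"
proof -
  interpret isostatic_quotient S \<theta> \<tau> G H D
    by (intro isostatic_quotient.intro oriented_quotient.intro isostatic_quotient_axioms.intro assms)
  obtain Cs where Cs: "Assur_run S \<theta> \<tau> G Cs" using run_exists by blast
  \<comment> \<open>The chain of an Assur run also supplies the witness for a maximal
    block-triangular form.\<close>
  have ch: "connected_chain arc_rel W Cs" by (rule run_chain[OF Cs])
  show ?thesis
    using Cs run_decomposition run_Assur maximal_blocks_exist[OF _ ch] blocks_decomposition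
    by blast
qed

end
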